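(* Assume that $\mathrm{cov}(\mathcal M)=\mathfrak c$. Let $\mathcal C$ be a class of topological semigroups containing all Tychonoff topological semigroups. An absolutely $\mathcal C$-closed semigroup $X$ is polybounded if $X$ admits a power-Lindelöf subinvariant topology.
   Context: $\mathfrak c$ is the cardinality of the continuum and $\mathrm{cov}(\mathcal M)$ is the smallest cardinality of a cover of the real line by meager sets. A topological semigroup is a semigroup with a topology making the binary operation continuous. A topological space is Tychonoff if it is homeomorphic to a subspace of some cube $[0,1]^\kappa$. For a class $\mathcal C$ of topological semigroups, a semigroup $X$ (carrying no topology) is absolutely $\mathcal C$-closed if for any homomorphism $h:X\to Y$ to a topological semigroup $Y\in\mathcal C$ the image $h[X]$ is closed in $Y$. A topological space is Lindelöf if every open cover has a countable subcover. A topology $\tau$ on a set $X$ is power-Lindelöf if every finite power $(X,\tau)^n$ is Lindelöf. For a semigroup $X$, $X^1=X\cup\{1\}$, where $1\notin X$ is a new element with $1x=x=x1$ for every $x\in X^1$. A pseudometric $d$ on $X$ is subinvariant if $d(axb,ayb)\le d(x,y)$ for all $x,y\in X$ and $a,b\in X^1$. A topology $\tau$ on a semigroup $X$ is subinvariant if for any distinct points $x,y\in X$ there exists a $\tau$-continuous subinvariant pseudometric $d$ on $X$ with $d(x,y)>0$. A subset $A\subseteq X$ is algebraic if $A=\{x\in X: a_0xa_1x\cdots xa_n=b\}$ for some integer $n\ge 1$, some $b\in X$ and some $a_0,\dots,a_n\in X^1$. A semigroup $X$ is polybounded if $X$ is the union of finitely many algebraic subsets of $X$. *)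

theory Defs
  imports "HOL-Analysis.Analysis"
begin

unbundle cardinal_syntax

section \<open>Covering the real line by meager sets\<close>

definition nowhere_dense :: "'a::topological_space set \<Rightarrow> bool" where
  "nowhere_dense A \<longleftrightarrow> interior (closure A) = {}"

definition meager :: "'a::topological_space set \<Rightarrow> bool" where
  "meager A \<longleftrightarrow> (\<exists>\<N>. countable \<N> \<and> (\<forall>N\<in>\<N>. nowhere_dense N) \<and> A = \<Union>\<N>)"

definition meager_cover :: "real set set \<Rightarrow> bool" where
  "meager_cover \<F> \<longleftrightarrow> (\<forall>A\<in>\<F>. meager A) \<and> \<Union>\<F> = UNIV"

text \<open>The least cardinal of a cover of the line by meager sets, as a cardinal order in the sense of
  the BNF cardinals; it is determined up to \<open>=o\<close>, see \<open>cov_meager_least\<close> below.\<close>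

definition cov_meager :: "real set rel" where
  "cov_meager = (SOME r. (\<exists>\<F>. meager_cover \<F> \<and> r = |\<F>| ) \<and>
                         (\<forall>\<G>. meager_cover \<G> \<longrightarrow> r \<le>o |\<G>| ))"

lemma meager_cover_singletons: "meager_cover (range (\<lambda>x. {x}))"
proof -
  have "meager {x}" for x :: real
    unfolding meager_def nowhere_dense_def by (rule exI[of _ "{{x}}"]) simp
  then show ?thesis by (auto simp: meager_cover_def)
qed

lemma cov_meager_least:
  shows "\<exists>\<F>. meager_cover \<F> \<and> cov_meager = |\<F>|"
    and "meager_cover \<G> \<Longrightarrow> cov_meager \<le>o |\<G>|"
proof -
  let ?P = "\<lambda>r. (\<exists>\<F>. meager_cover \<F> \<and> r = |\<F>| ) \<and> (\<forall>\<G>. meager_cover \<G> \<longrightarrow> r \<le>o |\<G>| )"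
  let ?R = "{ |\<F>| |\<F>. meager_cover \<F>}"
  have "?R \<noteq> {}" "\<forall>r\<in>?R. Card_order r"
    using meager_cover_singletons by (auto intro: card_of_Card_order)
  from exists_minim_Card_order[OF this] have "\<exists>r. ?P r" by blast
  then have "?P cov_meager" unfolding cov_meager_def by (rule someI_ex)
  then show "\<exists>\<F>. meager_cover \<F> \<and> cov_meager = |\<F>|"
    and "meager_cover \<G> \<Longrightarrow> cov_meager \<le>o |\<G>|" by blast+
qed

section \<open>Topological semigroups\<close>

definition semigroup_on :: "'a set \<Rightarrow> ('a \<Rightarrow> 'a \<Rightarrow> 'a) \<Rightarrow> bool" where
  "semigroup_on X f \<longleftrightarrow>
     (\<forall>x\<in>X. \<forall>y\<in>X. f x y \<in> X) \<and> (\<forall>x\<in>X. \<forall>y\<in>X. \<forall>z\<in>X. f (f x y) z = f x (f y z))"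

definition semigroup_hom ::
  "'a set \<Rightarrow> ('a \<Rightarrow> 'a \<Rightarrow> 'a) \<Rightarrow> 'b set \<Rightarrow> ('b \<Rightarrow> 'b \<Rightarrow> 'b) \<Rightarrow> ('a \<Rightarrow> 'b) \<Rightarrow> bool" where
  "semigroup_hom X f Y g h \<longleftrightarrow>
     h \<in> X \<rightarrow> Y \<and> (\<forall>x\<in>X. \<forall>y\<in>X. h (f x y) = g (h x) (h y))"

definition topological_semigroup :: "'b topology \<Rightarrow> ('b \<Rightarrow> 'b \<Rightarrow> 'b) \<Rightarrow> bool" where
  "topological_semigroup T g \<longleftrightarrow>
     semigroup_on (topspace T) g \<and> continuous_map (prod_topology T T) T (\<lambda>(x, y). g x y)"

text \<open>Cubes with index sets of functions \<^typ>\<open>'b \<Rightarrow> real\<close> suffice: by the lemma below a space that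
  embeds into some cube, with any index set whatsoever, embeds into such a cube.\<close>

definition Tychonoff_space :: "'b topology \<Rightarrow> bool" where
  "Tychonoff_space T \<longleftrightarrow>
     (\<exists>(I :: ('b \<Rightarrow> real) set) S.
        T homeomorphic_space subtopology (product_topology (\<lambda>_. top_of_set {0..1::real}) I) S)"

lemma Tychonoff_space_if_in_cube:
  fixes I :: "'i set" and T :: "'b topology"
  assumes "T homeomorphic_space subtopology (product_topology (\<lambda>_. top_of_set {0..1::real}) I) S"
  shows "Tychonoff_space T"
proof -
  let ?Q = "subtopology (product_topology (\<lambda>_. top_of_set {0..1::real}) I) S"
  have "completely_regular_space ?Q"
    by (intro completely_regular_space_subtopology)
      (simp add: completely_regular_space_product_topology completely_regular_space_subtopology
        metrizable_imp_completely_regular_space metrizable_space_euclidean)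
  moreover have "Hausdorff_space ?Q"
    by (intro Hausdorff_space_subtopology)
      (simp add: Hausdorff_space_product_topology Hausdorff_space_subtopology)
  ultimately have "completely_regular_space T" "Hausdorff_space T"
    using assms homeomorphic_completely_regular_space homeomorphic_Hausdorff_space by blast+
  then obtain K :: "('b \<Rightarrow> real) set" and e
    where "embedding_map T (product_topology (\<lambda>f. top_of_set {0..1::real}) K) e"
    by (rule completely_regular_space_cube_embedding)
  then show ?thesis
    unfolding Tychonoff_space_def using embedding_map_imp_homeomorphic_space by blast
qed

text \<open>A class of topological semigroups is a set of pairs of a topology, whose \<^const>\<open>topspace\<close> is the
  carrier, and an operation, of which only the values on the carrier matter. The carriers live in
  one type \<open>'b\<close>. If \<open>'b\<close> is infinite and \<open>|X| \<le>o |UNIV :: 'b set|\<close>, then for all Tychonoff semigroups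
  this is no restriction: when \<open>h[X]\<close> is not closed in \<open>Y\<close> and \<open>y\<close> is in its closure but not in it,
  \<open>h[X]\<close> is not closed in the subsemigroup generated by \<open>h[X] \<union> {y}\<close> either, and that has a copy in \<open>'b\<close>.\<close>

definition absolutely_closed ::
  "('b topology \<times> ('b \<Rightarrow> 'b \<Rightarrow> 'b)) set \<Rightarrow> 'a set \<Rightarrow> ('a \<Rightarrow> 'a \<Rightarrow> 'a) \<Rightarrow> bool" where
  "absolutely_closed \<C> X f \<longleftrightarrow>
     (\<forall>(T, g)\<in>\<C>. \<forall>h. semigroup_hom X f (topspace T) g h \<longrightarrow> closedin T (h ` X))"

section \<open>Polynomials and polybounded semigroups\<close>

text \<open>The semigroup \<open>X\<^sup>1\<close>: the new unit is \<^term>\<open>None\<close>, also when \<open>X\<close> already has a unit.\<close>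

definition adjoin_unit :: "'a set \<Rightarrow> 'a option set" where
  "adjoin_unit X = insert None (Some ` X)"

fun unit_mult :: "('a \<Rightarrow> 'a \<Rightarrow> 'a) \<Rightarrow> 'a option \<Rightarrow> 'a option \<Rightarrow> 'a option" where
  "unit_mult f None v = v"
| "unit_mult f (Some u) None = Some u"
| "unit_mult f (Some u) (Some v) = Some (f u v)"

text \<open>\<open>semigroup_poly f a n x\<close> is \<open>a\<^sub>0 x a\<^sub>1 x \<dots> x a\<^sub>n\<close>, computed in \<open>X\<^sup>1\<close>.\<close>

primrec semigroup_poly ::
  "('a \<Rightarrow> 'a \<Rightarrow> 'a) \<Rightarrow> (nat \<Rightarrow> 'a option) \<Rightarrow> nat \<Rightarrow> 'a \<Rightarrow> 'a option" where
  "semigroup_poly f a 0 x = a 0"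
| "semigroup_poly f a (Suc n) x =
     unit_mult f (unit_mult f (semigroup_poly f a n x) (Some x)) (a (Suc n))"

definition algebraic_subset :: "'a set \<Rightarrow> ('a \<Rightarrow> 'a \<Rightarrow> 'a) \<Rightarrow> 'a set \<Rightarrow> bool" where
  "algebraic_subset X f A \<longleftrightarrow>
     (\<exists>n\<ge>1. \<exists>b\<in>X. \<exists>a. (\<forall>i\<le>n. a i \<in> adjoin_unit X) \<and>
        A = {x \<in> X. semigroup_poly f a n x = Some b})"

definition polybounded :: "'a set \<Rightarrow> ('a \<Rightarrow> 'a \<Rightarrow> 'a) \<Rightarrow> bool" where
  "polybounded X f \<longleftrightarrow> (\<exists>\<A>. finite \<A> \<and> (\<forall>A\<in>\<A>. algebraic_subset X f A) \<and> X = \<Union>\<A>)"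

section \<open>Power-Lindeloef and subinvariant topologies\<close>

definition power_Lindelof :: "'a topology \<Rightarrow> bool" where
  "power_Lindelof \<tau> \<longleftrightarrow> (\<forall>n::nat. Lindelof_space (product_topology (\<lambda>_. \<tau>) {..<n}))"

definition pseudometric_on :: "'a set \<Rightarrow> ('a \<Rightarrow> 'a \<Rightarrow> real) \<Rightarrow> bool" where
  "pseudometric_on X d \<longleftrightarrow>
     (\<forall>x\<in>X. \<forall>y\<in>X. 0 \<le> d x y \<and> d x y = d y x) \<and> (\<forall>x\<in>X. d x x = 0) \<and>
     (\<forall>x\<in>X. \<forall>y\<in>X. \<forall>z\<in>X. d x z \<le> d x y + d y z)"

text \<open>For \<open>x\<close> in \<open>X\<close> the product \<open>a x b\<close> in \<open>X\<^sup>1\<close> is never the new unit, so \<^const>\<open>the\<close> below is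
  applied to a value of the form \<open>Some z\<close> only.\<close>

definition subinvariant_pseudometric ::
  "'a set \<Rightarrow> ('a \<Rightarrow> 'a \<Rightarrow> 'a) \<Rightarrow> ('a \<Rightarrow> 'a \<Rightarrow> real) \<Rightarrow> bool" where
  "subinvariant_pseudometric X f d \<longleftrightarrow>
     pseudometric_on X d \<and>
     (\<forall>x\<in>X. \<forall>y\<in>X. \<forall>a\<in>adjoin_unit X. \<forall>b\<in>adjoin_unit X.
        d (the (unit_mult f (unit_mult f a (Some x)) b))
          (the (unit_mult f (unit_mult f a (Some y)) b)) \<le> d x y)"

definition subinvariant_topology :: "('a \<Rightarrow> 'a \<Rightarrow> 'a) \<Rightarrow> 'a topology \<Rightarrow> bool" where
  "subinvariant_topology f \<tau> \<longleftrightarrow>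
     (\<forall>x\<in>topspace \<tau>. \<forall>y\<in>topspace \<tau>. x \<noteq> y \<longrightarrow>
        (\<exists>d. subinvariant_pseudometric (topspace \<tau>) f d \<and>
             continuous_map (prod_topology \<tau> \<tau>) euclideanreal (\<lambda>(u, v). d u v) \<and> d x y > 0))"

end

theory Submission
  imports Defs
begin

text \<open>If \<open>X\<close> is absolutely closed, then adjoining to the discrete semigroup \<open>X\<close> a zero cannot give a
  Tychonoff semigroup in which \<open>X\<close> is not closed; so no filter base on \<open>X\<close> with empty intersection
  can serve as the neighbourhoods of such a zero. This is used three times.

  First let \<open>X\<close> carry a separable subinvariant metric. It is complete, because \<open>X\<close> is closed in its
  completion. If \<open>X\<close> were not covered by fewer than continuum many algebraic sets, a transfinite
  sequence that avoids all equations over its predecessors would tend to a zero. Chains of ideals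
  have nonempty intersection, so there is a minimal closed ideal \<open>M\<close>, and since
  \<open>cov(M) = c\<close> some polynomial is constant on a nonempty open subset of \<open>M\<close>. The points near which no
  polynomial is constant on \<open>M\<close> form a closed ideal, which is empty by minimality. Hence near each
  point of \<open>M\<close> some polynomial is constant, so that avoiding a small ball costs one algebraic
  set only, and if \<open>X\<close> is not polybounded, a sequence in \<open>M\<close> tending to a zero can be chosen by
  induction over a countable dense set of coefficients.

  A power-Lindeloef topology reduces to this case: every continuous subinvariant pseudometric \<open>d\<close>
  has an absolutely closed separable metric quotient, which yields polynomials
  covering \<open>X\<close> modulo \<open>d\<close>. Countably many pseudometrics are dominated by a single one, so the shape of
  the polynomials can be chosen independently of \<open>d\<close>, and the coefficient tuples that work for \<open>d\<close> form
  closed sets of a Lindeloef power of \<open>X\<close> with the countable intersection property. A tuple common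
  to all of them works in \<open>X\<close> itself.\<close>

section \<open>Words and patterns\<close>

text \<open>Without a unit there is no empty product; the lemmas below ask for nonempty
  words.\<close>

fun list_product :: "('a \<Rightarrow> 'a \<Rightarrow> 'a) \<Rightarrow> 'a list \<Rightarrow> 'a" where
  "list_product f [] = undefined"
| "list_product f [x] = x"
| "list_product f (x # y # ys) = f x (list_product f (y # ys))"

text \<open>In a pattern, \<^term>\<open>None\<close> marks the places of the variable, unlike in
  \<^const>\<open>adjoin_unit\<close>, where it is the unit.\<close>

definition pattern_value :: "('a \<Rightarrow> 'a \<Rightarrow> 'a) \<Rightarrow> 'a option list \<Rightarrow> 'a \<Rightarrow> 'a" where
  "pattern_value f w x = list_product f (map (case_option x id) w)"

text \<open>The variable has to occur, which gives the degree n >= 1 demanded by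
  \<open>algebraic_subset\<close>; a constant word would solve c = c everywhere.\<close>

definition patterns :: "'a set \<Rightarrow> 'a option list set" where
  "patterns S = {w \<in> lists (insert None (Some ` S)). None \<in> set w}"

text \<open>Substituting v pulls equations back along the polynomial map of v. Covers and local
  constancy are transported in this way.\<close>

definition pattern_comp :: "'a option list \<Rightarrow> 'a option list \<Rightarrow> 'a option list" where
  "pattern_comp w v = concat (map (\<lambda>l. case l of None \<Rightarrow> v | Some c \<Rightarrow> [Some c]) w)"

lemma patternsI:
  "(\<And>c. Some c \<in> set w \<Longrightarrow> c \<in> S) \<Longrightarrow> None \<in> set w \<Longrightarrow> w \<in> patterns S"
  unfolding patterns_def in_lists_conv_set
  by (smt (verit) image_eqI insertCI mem_Collect_eq not_None_eq)

lemma patternsD: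
  assumes "w \<in> patterns S"
  shows "Some c \<in> set w \<Longrightarrow> c \<in> S" "None \<in> set w" "w \<noteq> []"
  using assms unfolding patterns_def by (auto simp: in_lists_conv_set)

lemma patterns_mono: "S \<subseteq> T \<Longrightarrow> patterns S \<subseteq> patterns T"
  by (meson patternsD patternsI subset_iff)

lemma patterns_letters:
  assumes "w \<in> patterns S" "x \<in> X" "S \<subseteq> X"
  shows "map (case_option x id) w \<in> lists X"
  using assms patternsD[OF assms(1)] by (auto simp: in_lists_conv_set split: option.split)

lemma pattern_comp_in_patterns:
  assumes "w \<in> patterns S" "v \<in> patterns S"
  shows "pattern_comp w v \<in> patterns S"
proof (rule patternsI)
  show "c \<in> S" if "Some c \<in> set (pattern_comp w v)" for c
    using that patternsD[OF assms(1)] patternsD[OF assms(2)]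
    by (auto simp: pattern_comp_def split: option.splits)
  show "None \<in> set (pattern_comp w v)"
    using patternsD[OF assms(1)] patternsD[OF assms(2)]
    by (force simp: pattern_comp_def intro!: bexI[of _ None])
qed

text \<open>A word containing x is read as a polynomial evaluated at x, so that a product taking a
  known value becomes an equation for x.\<close>

definition abstract_letter :: "'a \<Rightarrow> 'a list \<Rightarrow> 'a option list" where
  "abstract_letter x u = map (\<lambda>l. if l = x then None else Some l) u"

lemma abstract_letter_in_patterns:
  "u \<in> lists (insert x S) \<Longrightarrow> x \<in> set u \<Longrightarrow> abstract_letter x u \<in> patterns S"
  by (rule patternsI) (auto simp: abstract_letter_def in_lists_conv_set split: if_splits)

lemma pattern_value_abstract_letter:
  "pattern_value f (abstract_letter x u) x = list_product f u"
  unfolding pattern_value_def abstract_letter_def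
  by (simp add: comp_def if_distrib cong: if_cong)

lemma length_abstract_letter [simp]: "length (abstract_letter x u) = length u"
  by (simp add: abstract_letter_def)

locale carrier_semigroup =
  fixes X :: "'a set" and f :: "'a \<Rightarrow> 'a \<Rightarrow> 'a"
  assumes semigroup: "semigroup_on X f"
begin

lemma mult_closed [simp, intro]: "x \<in> X \<Longrightarrow> y \<in> X \<Longrightarrow> f x y \<in> X"
  using semigroup by (auto simp: semigroup_on_def)

lemma mult_assoc: "x \<in> X \<Longrightarrow> y \<in> X \<Longrightarrow> z \<in> X \<Longrightarrow> f (f x y) z = f x (f y z)"
  using semigroup by (auto simp: semigroup_on_def)

lemma list_product_Cons: "xs \<noteq> [] \<Longrightarrow> list_product f (x # xs) = f x (list_product f xs)"
  by (cases xs) auto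

lemma list_product_closed: "xs \<noteq> [] \<Longrightarrow> xs \<in> lists X \<Longrightarrow> list_product f xs \<in> X"
  by (induction xs rule: induct_list012) auto

lemma list_product_append:
  "xs \<noteq> [] \<Longrightarrow> ys \<noteq> [] \<Longrightarrow> xs \<in> lists X \<Longrightarrow> ys \<in> lists X \<Longrightarrow>
   list_product f (xs @ ys) = f (list_product f xs) (list_product f ys)"
proof (induction xs)
  case (Cons x xs)
  show ?case
  proof (cases "xs = []")
    case True then show ?thesis using Cons.prems by (simp add: list_product_Cons)
  next
    case False
    then show ?thesis using Cons mult_assoc[of x "list_product f xs" "list_product f ys"]
      by (simp add: list_product_Cons list_product_closed)
  qed
qed simp

lemma pattern_value_closed:
  assumes "w \<in> patterns X" "x \<in> X"
  shows "pattern_value f w x \<in> X"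
  unfolding pattern_value_def
  using patterns_letters[OF assms order_refl] patternsD[OF assms(1)]
  by (intro list_product_closed) auto

lemma pattern_value_comp:
  assumes "w \<in> patterns X" "v \<in> patterns X" "x \<in> X"
  shows "pattern_value f (pattern_comp w v) x = pattern_value f w (pattern_value f v x)"
proof -
  have v: "v \<noteq> []" "map (case_option x id) v \<in> lists X"
    using patternsD(3)[OF assms(2)] patterns_letters[OF assms(2,3) order_refl] by auto
  let ?y = "pattern_value f v x"
  have y: "?y \<in> X" using assms pattern_value_closed by blast
  \<comment> \<open>Tails of a pattern may lose the variable, so the induction runs over all
    nonempty words with coefficients in X.\<close>
  have *: "list_product f (map (case_option x id) (pattern_comp w v))
      = list_product f (map (case_option ?y id) w)
      \<and> map (case_option x id) (pattern_comp w v) \<in> lists X \<and> pattern_comp w v \<noteq> []"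
    if "w \<noteq> []" "\<And>c. Some c \<in> set w \<Longrightarrow> c \<in> X" for w
    using that
  proof (induction w)
    case (Cons l w)
    let ?l = "case l of None \<Rightarrow> v | Some c \<Rightarrow> [Some c]"
    have l: "map (case_option x id) ?l \<in> lists X" "?l \<noteq> []"
      "list_product f (map (case_option x id) ?l) = case_option ?y id l"
      using v Cons.prems by (auto split: option.split simp: pattern_value_def)
    have eq: "pattern_comp (l # w) v = ?l @ pattern_comp w v"
      by (simp add: pattern_comp_def)
    show ?case
    proof (cases "w = []")
      case True
      then show ?thesis unfolding eq using l by (auto simp: pattern_comp_def)
    next
      case False
      then have IH: "list_product f (map (case_option x id) (pattern_comp w v))
        = list_product f (map (case_option ?y id) w)"
        "map (case_option x id) (pattern_comp w v) \<in> lists X" "pattern_comp w v \<noteq> []"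
        using Cons.IH Cons.prems(2) by (meson list.set_intros(2))+
      then show ?thesis unfolding eq using l False
        by (simp add: list_product_append list_product_Cons)
    qed
  qed simp
  show ?thesis
    unfolding pattern_value_def[of _ "pattern_comp w v"] pattern_value_def[of _ w]
    using * patternsD[OF assms(1)] by blast
qed

section \<open>Patterns as polynomials over the semigroup with adjoined unit\<close>

lemma unit_mult_closed:
  "u \<in> adjoin_unit X \<Longrightarrow> v \<in> adjoin_unit X \<Longrightarrow> unit_mult f u v \<in> adjoin_unit X"
  by (auto simp: adjoin_unit_def)

lemma unit_mult_None_right [simp]: "unit_mult f u None = u"
  by (cases u) auto

lemma unit_mult_assoc:
  "u \<in> adjoin_unit X \<Longrightarrow> v \<in> adjoin_unit X \<Longrightarrow> w \<in> adjoin_unit X \<Longrightarrow>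
   unit_mult f (unit_mult f u v) w = unit_mult f u (unit_mult f v w)"
  by (auto simp: adjoin_unit_def mult_assoc)

lemma semigroup_poly_cong:
  "(\<And>i. i \<le> n \<Longrightarrow> a i = a' i) \<Longrightarrow> semigroup_poly f a n x = semigroup_poly f a' n x"
  by (induction n) auto

lemma semigroup_poly_closed:
  "(\<And>i. a i \<in> adjoin_unit X) \<Longrightarrow> x \<in> X \<Longrightarrow> semigroup_poly f a n x \<in> adjoin_unit X"
proof (induction n)
  case (Suc n)
  then show ?case
    by (auto intro!: unit_mult_closed) (simp add: adjoin_unit_def)
qed simp

text \<open>Induction on the last letter: a variable opens a new coefficient, set to the unit, while
  a constant is multiplied into the last coefficient. The degree counts the variables.\<close>

lemma pattern_value_eq_semigroup_poly:
  assumes "w \<noteq> []" "\<And>c. Some c \<in> set w \<Longrightarrow> c \<in> X"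
  shows "\<exists>a. (\<forall>i. a i \<in> adjoin_unit X) \<and>
    (\<forall>x\<in>X. semigroup_poly f a (length (filter (\<lambda>l. l = None) w)) x = Some (pattern_value f w x))"
  using assms
proof (induction w rule: rev_nonempty_induct)
  case (single l)
  show ?case
  proof (cases l)
    case None
    then show ?thesis
      by (intro exI[of _ "\<lambda>_. None"]) (auto simp: adjoin_unit_def pattern_value_def)
  next
    case (Some c)
    then show ?thesis using single
      by (intro exI[of _ "\<lambda>_. Some c"]) (auto simp: adjoin_unit_def pattern_value_def)
  qed
next
  case (snoc l w)
  let ?n = "length (filter (\<lambda>l. l = None) w)"
  obtain a where a: "\<And>i. a i \<in> adjoin_unit X"
    "\<And>x. x \<in> X \<Longrightarrow> semigroup_poly f a ?n x = Some (pattern_value f w x)"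
    using snoc.IH snoc.prems by (metis UnI1 set_append)
  have letters: "map (case_option x id) w \<in> lists X" if "x \<in> X" for x
    using snoc.prems that by (force simp: in_lists_conv_set split: option.splits)
  have val: "pattern_value f (w @ [l]) x = f (pattern_value f w x) (case_option x id l)"
    if "x \<in> X" for x
    using snoc.hyps snoc.prems letters[OF that] that
    by (auto simp: pattern_value_def list_product_append split: option.splits)
  show ?case
  proof (cases l)
    case None
    define b where "b = a(Suc ?n := None)"
    have "semigroup_poly f b ?n x = semigroup_poly f a ?n x" for x
      by (rule semigroup_poly_cong) (auto simp: b_def)
    moreover have "b (Suc ?n) = None" "b i \<in> adjoin_unit X" for i
      using a(1) by (auto simp: b_def adjoin_unit_def)
    ultimately show ?thesis using None a(2) val
      by (intro exI[of _ b]) auto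
  next
    case (Some c)
    then have c: "c \<in> X" using snoc.prems by auto
    define b where "b = a(?n := unit_mult f (a ?n) (Some c))"
    have "semigroup_poly f b ?n x = unit_mult f (semigroup_poly f a ?n x) (Some c)" if "x \<in> X" for x
    proof (cases ?n)
      case 0
      then show ?thesis by (simp add: b_def)
    next
      case (Suc m)
      have "semigroup_poly f b m x = semigroup_poly f a m x"
        by (rule semigroup_poly_cong) (auto simp: b_def Suc)
      moreover have "unit_mult f (semigroup_poly f a m x) (Some x) \<in> adjoin_unit X"
        using semigroup_poly_closed[OF a(1) that] that
        by (intro unit_mult_closed) (auto simp: adjoin_unit_def)
      ultimately show ?thesis using a(1) c unfolding Suc
        by (simp add: b_def Suc unit_mult_assoc adjoin_unit_def)
    qed
    moreover have "Some c \<in> adjoin_unit X" using c by (simp add: adjoin_unit_def)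
    then have "b i \<in> adjoin_unit X" for i
      using a(1) unit_mult_closed by (simp add: b_def)
    ultimately show ?thesis using Some a(2) val
      by (intro exI[of _ b]) auto
  qed
qed

lemma algebraic_subset_pattern:
  assumes "w \<in> patterns X" "b \<in> X"
  shows "algebraic_subset X f {x \<in> X. pattern_value f w x = b}"
proof -
  let ?n = "length (filter (\<lambda>l. l = None) w)"
  obtain a where a: "\<And>i. a i \<in> adjoin_unit X"
    "\<And>x. x \<in> X \<Longrightarrow> semigroup_poly f a ?n x = Some (pattern_value f w x)"
    using pattern_value_eq_semigroup_poly patternsD[OF assms(1)] by metis
  have "?n \<ge> 1"
    using patternsD(2)[OF assms(1)] by (metis (mono_tags, lifting) One_nat_def Suc_leI filter_empty_conv length_greater_0_conv)
  then show ?thesis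
    unfolding algebraic_subset_def using a assms(2)
    by (intro exI[of _ ?n] conjI bexI[of _ b] exI[of _ a]) auto
qed

text \<open>Subsets are allowed because a cover of an ideal is carried over to X by
  \<open>finitely_covered_ideal\<close>.\<close>

definition finitely_covered :: "'a set \<Rightarrow> bool" where
  "finitely_covered A \<longleftrightarrow>
     (\<exists>\<P>. finite \<P> \<and> \<P> \<subseteq> patterns X \<times> X \<and> (\<forall>x\<in>A. \<exists>(w, b)\<in>\<P>. pattern_value f w x = b))"

lemma finitely_covered_imp_polybounded:
  assumes "finitely_covered X"
  shows "polybounded X f"
proof -
  obtain \<P> where P: "finite \<P>" "\<P> \<subseteq> patterns X \<times> X"
    "\<forall>x\<in>X. \<exists>(w, b)\<in>\<P>. pattern_value f w x = b"
    using assms unfolding finitely_covered_def by blast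
  let ?A = "\<lambda>(w, b). {x \<in> X. pattern_value f w x = b}"
  have "algebraic_subset X f (?A p)" if "p \<in> \<P>" for p
    using that P(2) algebraic_subset_pattern by (cases p) auto
  moreover have "X = \<Union> (?A ` \<P>)"
    using P(3) by (auto simp: split_beta)
  ultimately show ?thesis
    unfolding polybounded_def using P(1) by (intro exI[of _ "?A ` \<P>"]) auto
qed

end

section \<open>Homomorphisms to Tychonoff semigroups on arbitrary types\<close>

lemma card_of_lists_ordLeq:
  assumes "infinite B" "|A| \<le>o |B|"
  shows "|lists A| \<le>o |B|"
proof -
  have len: "|{xs \<in> lists A. length xs = n}| \<le>o |B|" for n
  proof (induction n)
    case 0
    have "{xs \<in> lists A. length xs = 0} = {[]}" by auto
    moreover have "B \<noteq> {}" using assms(1) by auto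
    ultimately show ?case using card_of_singl_ordLeq by metis
  next
    case (Suc n)
    let ?L = "{xs \<in> lists A. length xs = n}"
    have "{xs \<in> lists A. length xs = Suc n} = (\<lambda>(x, xs). x # xs) ` (A \<times> ?L)"
      by (auto simp: length_Suc_conv image_iff)
    moreover have "|A \<times> ?L| \<le>o |B|"
      using assms Suc.IH by (intro card_of_Times_ordLeq_infinite_Field) (simp_all add: Field_card_of card_of_card_order_on)
    ultimately show ?case using ordLeq_transitive[OF card_of_image] by simp
  qed
  have "lists A = (\<Union>n. {xs \<in> lists A. length xs = n})" by auto
  moreover have "|\<Union>n. {xs \<in> lists A. length xs = n}| \<le>o |B|"
    using assms(1) len infinite_iff_card_of_nat by (intro card_of_UNION_ordLeq_infinite) auto
  ultimately show ?thesis by simp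
qed

locale absolutely_closed_semigroup = carrier_semigroup X f
  for X :: "'a set" and f +
  fixes \<C> :: "('b topology \<times> ('b \<Rightarrow> 'b \<Rightarrow> 'b)) set"
  assumes infinite_type: "infinite (UNIV :: 'b set)"
    and card_carrier: "|X| \<le>o |UNIV :: 'b set|"
    and Tychonoff_in_class:
      "topological_semigroup T g \<Longrightarrow> Tychonoff_space T \<Longrightarrow> (T, g) \<in> \<C>"
    and closed_images: "absolutely_closed \<C> X f"
begin

text \<open>A point \<open>y\<close> in the closure of the image is already in the closure within the subsemigroup
  generated by the image and \<open>y\<close>, which has a copy in the type \<open>'b\<close>.\<close>

lemma closedin_image:
  fixes T :: "'c topology"
  assumes T: "topological_semigroup T g" "completely_regular_space T" "Hausdorff_space T"
    and h: "semigroup_hom X f (topspace T) g h"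
  shows "closedin T (h ` X)"
proof -
  interpret T: carrier_semigroup "topspace T" g
    using T(1) by unfold_locales (auto simp: topological_semigroup_def)
  have hX: "h ` X \<subseteq> topspace T" using h by (auto simp: semigroup_hom_def)
  have "y \<in> h ` X" if y: "y \<in> T closure_of (h ` X)" for y
  proof -
    define L where "L = insert y (h ` X)"
    have L: "L \<subseteq> topspace T"
      using hX y closure_of_subset_topspace[of T "h ` X"] unfolding L_def by blast
    define S where "S = list_product g ` {u \<in> lists L. u \<noteq> []}"
    have S: "S \<subseteq> topspace T"
      unfolding S_def using T.list_product_closed lists_mono[OF L] by blast
    have S_mult: "g s t \<in> S" if "s \<in> S" "t \<in> S" for s t
    proof -
      obtain u where u: "u \<in> lists L" "u \<noteq> []" "s = list_product g u"
        using \<open>s \<in> S\<close> unfolding S_def by auto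
      obtain v where v: "v \<in> lists L" "v \<noteq> []" "t = list_product g v"
        using \<open>t \<in> S\<close> unfolding S_def by auto
      have "lists L \<subseteq> lists (topspace T)" using L by (rule lists_mono)
      then have "g s t = list_product g (u @ v)"
        using u v T.list_product_append by (metis subsetD)
      then show ?thesis using u v by (auto simp: S_def)
    qed
    have LS: "L \<subseteq> S"
    proof
      fix l assume "l \<in> L"
      then have "l = list_product g [l]" "[l] \<in> {u \<in> lists L. u \<noteq> []}" by auto
      then show "l \<in> S" unfolding S_def by blast
    qed
    have "|h ` X| \<le>o |UNIV :: 'b set|"
      by (rule ordLeq_transitive[OF card_of_image card_carrier])
    moreover have "|{y}| \<le>o |UNIV :: 'b set|" by (rule card_of_singl_ordLeq) simp
    ultimately have "|{y} \<union> h ` X| \<le>o |UNIV :: 'b set|"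
      using infinite_type by (intro card_of_Un_ordLeq_infinite_Field) (simp_all add: Field_card_of card_of_card_order_on)
    then have "|lists L| \<le>o |UNIV :: 'b set|"
      unfolding L_def using infinite_type by (intro card_of_lists_ordLeq) auto
    moreover have "|S| \<le>o |{u \<in> lists L. u \<noteq> []}|" unfolding S_def by (rule card_of_image)
    moreover have "|{u \<in> lists L. u \<noteq> []}| \<le>o |lists L|" by (rule card_of_mono1) auto
    ultimately have "|S| \<le>o |UNIV :: 'b set|" by (metis (no_types) ordLeq_transitive)
    then obtain i :: "'c \<Rightarrow> 'b" where i: "inj_on i S"
      using card_of_ordLeq by metis
    \<comment> \<open>The topology of S is transported to its copy in \<open>'b\<close> by pulling
      it back along the inverse of i.\<close>
    define j where "j = inv_into S i"
    have ji [simp]: "j (i s) = s" if "s \<in> S" for s using i that by (simp add: j_def)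
    define T' where "T' = pullback_topology (i ` S) j T"
    define g' where "g' = (\<lambda>u v. i (g (j u) (j v)))"
    have top: "topspace T' = i ` S"
      unfolding T'_def topspace_pullback_topology using S by (auto)
    have j: "continuous_map T' T j"
      using continuous_map_pullback[of T T id "i ` S" j] unfolding T'_def by simp
    have jS: "continuous_map T' (subtopology T S) j"
      using j top by (auto simp: continuous_map_in_subtopology)
    have iS: "continuous_map (subtopology T S) T' i"
      unfolding T'_def
    proof (rule continuous_map_pullback')
      have "continuous_map (subtopology T S) T id"
        by (simp add: continuous_map_from_subtopology)
      then show "continuous_map (subtopology T S) T (j \<circ> i)"
        by (rule continuous_map_eq) (use S in auto)
    qed (use S in auto)
    have "homeomorphic_maps (subtopology T S) T' i j"
      unfolding homeomorphic_maps_def using iS jS S top by auto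
    then have hom: "subtopology T S homeomorphic_space T'"
      by (auto simp: homeomorphic_space_def)
    have "completely_regular_space T'" "Hausdorff_space T'"
      using hom T completely_regular_space_subtopology Hausdorff_space_subtopology
        homeomorphic_completely_regular_space homeomorphic_Hausdorff_space by blast+
    then obtain K :: "('b \<Rightarrow> real) set" and e
      where "embedding_map T' (product_topology (\<lambda>f. top_of_set {0..1::real}) K) e"
      by (rule completely_regular_space_cube_embedding)
    then have tych: "Tychonoff_space T'"
      unfolding Tychonoff_space_def using embedding_map_imp_homeomorphic_space by blast
    have sg: "topological_semigroup T' g'"
      unfolding topological_semigroup_def
    proof
      show "semigroup_on (topspace T') g'"
        unfolding semigroup_on_def top g'_def
        using S_mult S T.mult_assoc by (auto simp: subset_iff)
      have gc: "continuous_map (prod_topology T T) T (\<lambda>(x, y). g x y)"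
        using T(1) by (simp add: topological_semigroup_def)
      have "continuous_map (prod_topology T' T') (prod_topology T T) (\<lambda>(u, v). (j u, j v))"
        using j by (simp add: continuous_map_prod_top)
      from continuous_map_compose[OF this gc]
      have c: "continuous_map (prod_topology T' T') T (j \<circ> (\<lambda>(u, v). g' u v))"
        by (rule continuous_map_eq) (auto simp: top g'_def S_mult)
      show "continuous_map (prod_topology T' T') T' (\<lambda>(u, v). g' u v)"
        unfolding T'_def
      proof (rule continuous_map_pullback')
        show "continuous_map (prod_topology (pullback_topology (i ` S) j T) (pullback_topology (i ` S) j T))
          T (j \<circ> (\<lambda>(u, v). g' u v))"
          using c unfolding T'_def .
      qed (use S_mult in \<open>auto simp: g'_def topspace_pullback_topology\<close>)
    qed
    have "semigroup_hom X f (topspace T') g' (i \<circ> h)"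
      using h LS by (auto simp: semigroup_hom_def top g'_def L_def image_subset_iff)
    then have "closedin T' ((i \<circ> h) ` X)"
      using Tychonoff_in_class[OF sg tych] closed_images unfolding absolutely_closed_def by fastforce
    from closedin_continuous_map_preimage[OF iS this]
    have "closedin (subtopology T S) {x \<in> topspace (subtopology T S). i x \<in> (i \<circ> h) ` X}" .
    moreover have "{x \<in> topspace (subtopology T S). i x \<in> (i \<circ> h) ` X} = h ` X"
    proof -
      have "h ` X \<subseteq> S" using LS by (simp add: L_def)
      moreover have "topspace (subtopology T S) = S" using S by auto
      ultimately show ?thesis
        unfolding image_comp[symmetric] using inj_on_image_mem_iff[OF i] by blast
    qed
    \<comment> \<open>Since y lies in S, closedness of the image relative to S is enough to put y
      into the image.\<close>
    ultimately obtain K where K: "closedin T K" "h ` X = K \<inter> S"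
      by (auto simp: closedin_subtopology)
    then have "y \<in> K" using y closure_of_minimal by (metis Int_lower1 subsetD)
    then show ?thesis using K LS by (auto simp: L_def)
  qed
  then show ?thesis using hX by (metis closure_of_subset_eq subsetI)
qed

text \<open>Otherwise the sets \<open>{0} \<union> U\<close> would form a neighbourhood base of a zero adjoined to the discrete
  semigroup \<open>X\<close>, making a Tychonoff semigroup in which \<open>X\<close> is not closed.\<close>

lemma zero_neighbourhoods_have_common_point:
  assumes nonempty: "\<U> \<noteq> {}" "\<And>U. U \<in> \<U> \<Longrightarrow> U \<subseteq> X" "\<And>U. U \<in> \<U> \<Longrightarrow> U \<noteq> {}"
    and directed: "\<And>U V. U \<in> \<U> \<Longrightarrow> V \<in> \<U> \<Longrightarrow> \<exists>W\<in>\<U>. W \<subseteq> U \<inter> V"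
    and square: "\<And>U. U \<in> \<U> \<Longrightarrow> \<exists>V\<in>\<U>. \<forall>x\<in>V. \<forall>y\<in>V. f x y \<in> U"
    and shift: "\<And>U a. U \<in> \<U> \<Longrightarrow> a \<in> X \<Longrightarrow> \<exists>V\<in>\<U>. \<forall>x\<in>V. f a x \<in> U \<and> f x a \<in> U"
  shows "\<Inter>\<U> \<noteq> {}"
proof
  assume inter: "\<Inter>\<U> = {}"
  \<comment> \<open>\<open>None\<close> is the new zero. All other points are isolated, and the sets
    of \<U> are the punctured basic neighbourhoods of zero.\<close>
  define opn where "opn W \<longleftrightarrow> W \<subseteq> insert None (Some ` X) \<and> (None \<in> W \<longrightarrow> (\<exists>U\<in>\<U>. Some ` U \<subseteq> W))"
    for W :: "'a option set"
  define T where "T = topology opn"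
  have "istopology opn"
    unfolding istopology_def
  proof (intro conjI allI impI)
    fix W W' assume W: "opn W" "opn W'"
    show "opn (W \<inter> W')"
      unfolding opn_def
    proof (intro conjI impI)
      assume "None \<in> W \<inter> W'"
      then obtain U U' where "U \<in> \<U>" "U' \<in> \<U>" "Some ` U \<subseteq> W" "Some ` U' \<subseteq> W'"
        using W by (auto simp: opn_def)
      moreover obtain V where "V \<in> \<U>" "V \<subseteq> U \<inter> U'"
        using directed \<open>U \<in> \<U>\<close> \<open>U' \<in> \<U>\<close> by meson
      ultimately show "\<exists>U\<in>\<U>. Some ` U \<subseteq> W \<inter> W'" by (intro bexI[of _ V]) (auto simp: image_subset_iff)
    qed (use W in \<open>auto simp: opn_def\<close>)
  next
    fix \<W> assume "\<forall>W\<in>\<W>. opn W"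
    then show "opn (\<Union>\<W>)" unfolding opn_def by (meson UnionE Union_least Union_upper subset_trans)
  qed
  then have opn: "openin T W \<longleftrightarrow> opn W" for W
    by (simp add: T_def topology_inverse')
  have top: "topspace T = insert None (Some ` X)"
  proof
    show "insert None (Some ` X) \<subseteq> topspace T"
    proof (rule openin_subset)
      obtain U where "U \<in> \<U>" using nonempty(1) by blast
      then have "Some ` U \<subseteq> insert None (Some ` X)" using nonempty(2) by blast
      then show "openin T (insert None (Some ` X))"
        using \<open>U \<in> \<U>\<close> by (auto simp: opn opn_def)
    qed
  qed (use openin_topspace[of T] opn opn_def in metis)
  have open_Some: "openin T W" if "W \<subseteq> Some ` X" for W
    using that by (auto simp: opn opn_def)
  have open_None: "openin T (insert None (Some ` U))" if "U \<in> \<U>" for U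
    using that nonempty by (auto simp: opn opn_def)
  \<comment> \<open>Here the empty intersection enters: a neighbourhood of zero that avoids a makes
    the point a closed.\<close>
  have open_compl: "openin T (topspace T - {Some a})" for a
  proof -
    obtain U where "U \<in> \<U>" "a \<notin> U" using inter by blast
    then show ?thesis using nonempty unfolding opn opn_def top by blast
  qed
  \<comment> \<open>If x is the zero, S consists of isolated points and its complement is clopen;
    otherwise {x} is clopen. Indicator functions then give complete regularity.\<close>
  have clopen: "\<exists>K. openin T K \<and> closedin T K \<and> x \<in> K \<and> K \<inter> S = {}"
    if "closedin T S" "x \<in> topspace T - S" for S x
  proof (cases x)
    case None
    then have "S \<subseteq> Some ` X" using that closedin_subset[OF that(1)] unfolding top by blast
    then have "closedin T (topspace T - S)"
      using open_Some by (simp add: closedin_diff)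
    moreover have "openin T (topspace T - S)" using that(1) by (simp add: closedin_def)
    ultimately show ?thesis using that(2) by blast
  next
    case (Some a)
    then have "openin T {Some a}" "closedin T {Some a}"
      using that(2) open_Some[of "{Some a}"] open_compl[of a] by (auto simp: closedin_def top)
    then show ?thesis using that(2) Some by blast
  qed
  have reg: "completely_regular_space T"
    unfolding completely_regular_space_def
  proof (intro allI impI)
    fix S x assume Sx: "closedin T S \<and> x \<in> topspace T - S"
    then obtain K where K: "openin T K" "closedin T K" "x \<in> K" "K \<inter> S = {}"
      using clopen by blast
    define k where "k = (\<lambda>z. if z \<in> K then 0 else (1::real))"
    have "continuous_map T (top_of_set {0..1}) k"
      unfolding continuous_map
    proof (intro conjI allI impI)
      fix U
      have "{z \<in> topspace T. k z \<in> U} = (if 0 \<in> U then K else {}) \<union> (if 1 \<in> U then topspace T - K else {})"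
        using closedin_subset[OF K(2)] by (auto simp: k_def)
      then show "openin T {z \<in> topspace T. k z \<in> U}"
        using K openin_Un[OF K(1), of "topspace T - K"] by (auto simp: closedin_def)
    qed (auto simp: k_def)
    then show "\<exists>k. continuous_map T (top_of_set {0..1}) k \<and> k x = 0 \<and> k ` S \<subseteq> {1::real}"
      using K by (intro exI[of _ k]) (auto simp: k_def)
  qed
  have haus: "Hausdorff_space T"
    unfolding Hausdorff_space_def
  proof (intro allI impI)
    fix x y assume xy: "x \<in> topspace T \<and> y \<in> topspace T \<and> x \<noteq> y"
    have *: "openin T {Some a} \<and> openin T (topspace T - {Some a})" if "Some a \<in> topspace T" for a
      using that open_Some[of "{Some a}"] open_compl by (auto simp: top)
    show "\<exists>U V. openin T U \<and> openin T V \<and> x \<in> U \<and> y \<in> V \<and> disjnt U V"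
    proof (cases x)
      case None
      then obtain a where "y = Some a" using xy by (cases y) auto
      then show ?thesis using * xy
        by (intro exI[of _ "topspace T - {Some a}"] exI[of _ "{Some a}"]) (auto simp: disjnt_def)
    next
      case (Some a)
      then show ?thesis using * xy
        by (intro exI[of _ "topspace T - {Some a}"] exI[of _ "{Some a}"]) (auto simp: disjnt_def)
    qed
  qed
  define m where "m u v = (case u of None \<Rightarrow> None | Some a \<Rightarrow>
    (case v of None \<Rightarrow> None | Some b \<Rightarrow> Some (f a b)))" for u v
  have m: "m None v = None" "m u None = None" "m (Some a) (Some b) = Some (f a b)" for u v a b
    by (auto simp: m_def split: option.split)
  have "continuous_map (prod_topology T T) T (\<lambda>(u, v). m u v)"
    unfolding continuous_map_def
  proof (intro conjI allI impI)
    show "(\<lambda>(u, v). m u v) \<in> topspace (prod_topology T T) \<rightarrow> topspace T"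
      by (auto simp: top m)
    fix W assume W: "openin T W"
    show "openin (prod_topology T T) {z \<in> topspace (prod_topology T T). (\<lambda>(u, v). m u v) z \<in> W}"
      unfolding openin_prod_topology_alt
    proof (intro allI impI)
      fix u v assume "(u, v) \<in> {z \<in> topspace (prod_topology T T). (\<lambda>(u, v). m u v) z \<in> W}"
      then have uv: "u \<in> topspace T" "v \<in> topspace T" "m u v \<in> W" by auto
      have "\<exists>A B. openin T A \<and> openin T B \<and> u \<in> A \<and> v \<in> B \<and> (\<forall>a\<in>A. \<forall>b\<in>B. m a b \<in> W)"
      proof -
        \<comment> \<open>Continuity uses \<open>square\<close> at (0, 0), \<open>shift\<close> at
          the mixed pairs, and discreteness at pairs from X.\<close>
        consider "u = None" "v = None" | b where "u = None" "v = Some b"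
          | a where "u = Some a" "v = None" | a b where "u = Some a" "v = Some b"
          by (cases u; cases v) auto
        then show ?thesis
        proof cases
        case 1
        then obtain U where "U \<in> \<U>" "Some ` U \<subseteq> W" "None \<in> W"
          using W uv by (auto simp: opn opn_def m)
        moreover obtain V where "V \<in> \<U>" "\<forall>x\<in>V. \<forall>y\<in>V. f x y \<in> U" using square \<open>U \<in> \<U>\<close> by blast
        ultimately show ?thesis using open_None \<open>u = None\<close> \<open>v = None\<close>
          by (intro exI[of _ "insert None (Some ` V)"]) (auto simp: m)
      next
        case (2 b)
        then obtain U where "U \<in> \<U>" "Some ` U \<subseteq> W" "None \<in> W" "b \<in> X"
          using W uv by (auto simp: opn opn_def m top)
        moreover obtain V where "V \<in> \<U>" "\<forall>x\<in>V. f b x \<in> U \<and> f x b \<in> U"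
          using shift \<open>U \<in> \<U>\<close> \<open>b \<in> X\<close> by blast
        ultimately show ?thesis using open_None open_Some[of "{Some b}"] \<open>u = None\<close> \<open>v = Some b\<close>
          by (intro exI[of _ "insert None (Some ` V)"] exI[of _ "{Some b}"]) (auto simp: m)
      next
        case (3 a)
        then obtain U where "U \<in> \<U>" "Some ` U \<subseteq> W" "None \<in> W" "a \<in> X"
          using W uv by (auto simp: opn opn_def m top)
        moreover obtain V where "V \<in> \<U>" "\<forall>x\<in>V. f a x \<in> U \<and> f x a \<in> U"
          using shift \<open>U \<in> \<U>\<close> \<open>a \<in> X\<close> by blast
        ultimately show ?thesis using open_None open_Some[of "{Some a}"] \<open>v = None\<close> \<open>u = Some a\<close>
          by (intro exI[of _ "{Some a}"] exI[of _ "insert None (Some ` V)"]) (auto simp: m)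
      next
        case (4 a b)
        then show ?thesis using open_Some[of "{Some a}"] open_Some[of "{Some b}"] uv
          by (intro exI[of _ "{Some a}"] exI[of _ "{Some b}"]) (auto simp: m top)
        qed
      qed
      then obtain A B where AB: "openin T A" "openin T B" "u \<in> A" "v \<in> B" "\<forall>a\<in>A. \<forall>b\<in>B. m a b \<in> W"
        by blast
      then show "\<exists>A B. openin T A \<and> openin T B \<and> u \<in> A \<and> v \<in> B \<and>
        A \<times> B \<subseteq> {z \<in> topspace (prod_topology T T). (\<lambda>(u, v). m u v) z \<in> W}"
        using openin_subset[OF AB(1)] openin_subset[OF AB(2)]
        by (intro exI[of _ A] exI[of _ B]) (auto simp: subset_iff)
    qed
  qed
  then have "topological_semigroup T m"
    unfolding topological_semigroup_def semigroup_on_def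
    by (simp add: top m ball_simps mult_assoc)
  moreover have "semigroup_hom X f (topspace T) m Some"
    by (auto simp: semigroup_hom_def top m)
  ultimately have "closedin T (Some ` X)" using reg haus by (intro closedin_image)
  moreover have "topspace T - Some ` X = {None}" by (auto simp: top)
  \<comment> \<open>The zero has become isolated, although each of its neighbourhoods contains a
    nonempty set from \<U>.\<close>
  ultimately have "opn {None}" by (simp add: closedin_def opn)
  then show False using nonempty(3) by (fastforce simp: opn_def)
qed

end

section \<open>Subinvariant pseudometrics\<close>

locale pseudometric_semigroup = carrier_semigroup X f
  for X :: "'a set" and f +
  fixes d :: "'a \<Rightarrow> 'a \<Rightarrow> real"
  assumes dist_nonneg: "x \<in> X \<Longrightarrow> y \<in> X \<Longrightarrow> 0 \<le> d x y"
    and dist_refl [simp]: "x \<in> X \<Longrightarrow> d x x = 0"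
    and dist_sym: "x \<in> X \<Longrightarrow> y \<in> X \<Longrightarrow> d x y = d y x"
    and dist_triangle: "x \<in> X \<Longrightarrow> y \<in> X \<Longrightarrow> z \<in> X \<Longrightarrow> d x z \<le> d x y + d y z"
    and dist_left: "a \<in> X \<Longrightarrow> x \<in> X \<Longrightarrow> y \<in> X \<Longrightarrow> d (f a x) (f a y) \<le> d x y"
    and dist_right: "a \<in> X \<Longrightarrow> x \<in> X \<Longrightarrow> y \<in> X \<Longrightarrow> d (f x a) (f y a) \<le> d x y"
begin

lemma dist_mult:
  assumes "x \<in> X" "y \<in> X" "x' \<in> X" "y' \<in> X"
  shows "d (f x y) (f x' y') \<le> d x x' + d y y'"
  using dist_triangle[of "f x y" "f x' y" "f x' y'"] dist_right[of y x x'] dist_left[of x' y y'] assms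
  by auto

lemma dist_list_product:
  fixes e :: real
  assumes "list_all2 (\<lambda>x y. x \<in> X \<and> y \<in> X \<and> d x y \<le> e) xs ys" "xs \<noteq> []"
  shows "d (list_product f xs) (list_product f ys) \<le> length xs * e"
  using assms
proof (induction xs ys rule: list_all2_induct)
  case (Cons x xs y ys)
  show ?case
  proof (cases "xs = []")
    case False
    then have "ys \<noteq> []" using Cons.hyps by auto
    moreover have "xs \<in> lists X" "ys \<in> lists X"
      using Cons.hyps(2) by (auto simp: list_all2_conv_all_nth in_lists_conv_set in_set_conv_nth)
    ultimately have "d (list_product f (x # xs)) (list_product f (y # ys))
      \<le> d x y + d (list_product f xs) (list_product f ys)"
      using dist_mult[of x "list_product f xs" y "list_product f ys"] Cons.hyps(1) False
      by (simp add: list_product_Cons list_product_closed)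
    also have "\<dots> \<le> e + length xs * e" using Cons.IH Cons.hyps(1) False by simp
    finally show ?thesis by (simp add: algebra_simps)
  qed (use Cons.hyps in auto)
qed simp

section \<open>The metric quotient of a pseudometric semigroup\<close>

definition representative :: "'a \<Rightarrow> 'a" where
  "representative x = (SOME y. y \<in> X \<and> d x y = 0)"

text \<open>Representatives replace equivalence classes: the quotient keeps the type of X, and its
  coefficients are already elements of X when equations are lifted back.\<close>

definition quotient_carrier :: "'a set" where
  "quotient_carrier = representative ` X"

definition quotient_mult :: "'a \<Rightarrow> 'a \<Rightarrow> 'a" where
  "quotient_mult x y = representative (f x y)"

text \<open>The value 0 off X is there because \<open>Metric_space\<close> asks for nonnegativity
  and symmetry at all arguments.\<close>

definition quotient_dist :: "'a \<Rightarrow> 'a \<Rightarrow> real" where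
  "quotient_dist x y = (if x \<in> X \<and> y \<in> X then d x y else 0)"

lemma representative:
  assumes "x \<in> X"
  shows "representative x \<in> X" "d x (representative x) = 0" "d (representative x) x = 0"
proof -
  have "representative x \<in> X \<and> d x (representative x) = 0"
    unfolding representative_def by (rule someI[of _ x]) (use assms in auto)
  then show "representative x \<in> X" "d x (representative x) = 0" "d (representative x) x = 0"
    using assms dist_sym by auto
qed

lemma dist_zero_trans:
  "x \<in> X \<Longrightarrow> y \<in> X \<Longrightarrow> z \<in> X \<Longrightarrow> d x y = 0 \<Longrightarrow> d y z = 0 \<Longrightarrow> d x z = 0"
  using dist_triangle[of x y z] dist_nonneg[of x z] by auto

lemma dist_zero_mult:
  "x \<in> X \<Longrightarrow> y \<in> X \<Longrightarrow> x' \<in> X \<Longrightarrow> y' \<in> X \<Longrightarrow> d x x' = 0 \<Longrightarrow> d y y' = 0 \<Longrightarrow>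
   d (f x y) (f x' y') = 0"
  using dist_mult[of x y x' y'] dist_nonneg[of "f x y" "f x' y'"] by auto

lemma representative_eq_iff:
  assumes "x \<in> X" "y \<in> X"
  shows "representative x = representative y \<longleftrightarrow> d x y = 0"
proof
  assume "representative x = representative y"
  then show "d x y = 0" using representative[OF assms(1)] representative[OF assms(2)] assms
    by (metis dist_zero_trans)
next
  assume xy: "d x y = 0"
  then have "d x z = 0 \<longleftrightarrow> d y z = 0" if "z \<in> X" for z
    using assms that dist_zero_trans[of x y z] dist_zero_trans[of y x z] dist_sym[of x y] by auto
  then have "(\<lambda>z. z \<in> X \<and> d x z = 0) = (\<lambda>z. z \<in> X \<and> d y z = 0)" by auto
  then show "representative x = representative y" by (simp add: representative_def)
qed

lemma representative_mult:
  "x \<in> X \<Longrightarrow> y \<in> X \<Longrightarrow>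
   representative (f x y) = quotient_mult (representative x) (representative y)"
  unfolding quotient_mult_def
  by (simp add: representative_eq_iff representative dist_zero_mult)

lemma quotient_dist_representative:
  assumes "x \<in> X" "y \<in> X"
  shows "quotient_dist (representative x) (representative y) = d x y"
  using dist_triangle[of x "representative x" y]
    dist_triangle[of "representative x" "representative y" y]
    dist_triangle[of "representative x" x "representative y"]
    dist_triangle[of x y "representative y"]
    representative[OF assms(1)] representative[OF assms(2)] assms
  by (auto simp: quotient_dist_def)

end

locale metric_semigroup = carrier_semigroup X f + Metric_space X d
  for X :: "'a set" and f d +
  assumes left_subinvariant: "a \<in> X \<Longrightarrow> x \<in> X \<Longrightarrow> y \<in> X \<Longrightarrow> d (f a x) (f a y) \<le> d x y"
    and right_subinvariant: "a \<in> X \<Longrightarrow> x \<in> X \<Longrightarrow> y \<in> X \<Longrightarrow> d (f x a) (f y a) \<le> d x y"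
begin

sublocale pseudometric_semigroup X f d
  using commute triangle left_subinvariant right_subinvariant by unfold_locales auto

lemma topological_semigroup_mtopology: "topological_semigroup mtopology f"
  unfolding topological_semigroup_def continuous_map_def topspace_prod_topology topspace_mtopology
proof (intro conjI allI impI)
  fix W assume W: "openin mtopology W"
  show "openin (prod_topology mtopology mtopology) {z \<in> X \<times> X. (\<lambda>(x, y). f x y) z \<in> W}"
    unfolding openin_prod_topology_alt
  proof (intro allI impI)
    fix x y assume "(x, y) \<in> {z \<in> X \<times> X. (\<lambda>(x, y). f x y) z \<in> W}"
    then have xy: "x \<in> X" "y \<in> X" "f x y \<in> W" by auto
    then obtain r where r: "r > 0" "mball (f x y) r \<subseteq> W"
      using W by (auto simp: openin_mtopology)
    have "f u v \<in> W" if "u \<in> mball x (r / 2)" "v \<in> mball y (r / 2)" for u v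
      using that xy r dist_mult[of x y u v] by (auto simp: subset_iff)
    then show "\<exists>U V. openin mtopology U \<and> openin mtopology V \<and> x \<in> U \<and> y \<in> V \<and>
      U \<times> V \<subseteq> {z \<in> X \<times> X. (\<lambda>(x, y). f x y) z \<in> W}"
      using xy r by (intro exI[of _ "mball x (r / 2)"] exI[of _ "mball y (r / 2)"]) auto
  qed
qed (use semigroup in auto)

end

context pseudometric_semigroup
begin

lemma quotient_metric_semigroup:
  "metric_semigroup quotient_carrier quotient_mult quotient_dist"
proof
  show "semigroup_on quotient_carrier quotient_mult"
    unfolding semigroup_on_def quotient_carrier_def
    by (auto simp: ball_simps mult_assoc simp flip: representative_mult)
  show "0 \<le> quotient_dist x y" "quotient_dist x y = quotient_dist y x" for x y
    using dist_nonneg dist_sym by (auto simp: quotient_dist_def)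
  show "quotient_dist x y = 0 \<longleftrightarrow> x = y" if "x \<in> quotient_carrier" "y \<in> quotient_carrier" for x y
    using that by (auto simp: quotient_carrier_def quotient_dist_representative representative_eq_iff)
  show "quotient_dist x z \<le> quotient_dist x y + quotient_dist y z"
    if "x \<in> quotient_carrier" "y \<in> quotient_carrier" "z \<in> quotient_carrier" for x y z
    using that by (auto simp: quotient_carrier_def quotient_dist_representative dist_triangle)
  show "quotient_dist (quotient_mult a x) (quotient_mult a y) \<le> quotient_dist x y"
    "quotient_dist (quotient_mult x a) (quotient_mult y a) \<le> quotient_dist x y"
    if "a \<in> quotient_carrier" "x \<in> quotient_carrier" "y \<in> quotient_carrier" for a x y
    using that by (auto simp: quotient_carrier_def quotient_dist_representative dist_left dist_right
        simp flip: representative_mult)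
qed

end

text \<open>A homomorphism out of Y composed with r is one out of X with the same image.\<close>

lemma absolutely_closed_semigroup_image:
  assumes "absolutely_closed_semigroup X f \<C>" "semigroup_on Y g" "semigroup_hom X f Y g r"
    "r ` X = Y"
  shows "absolutely_closed_semigroup Y g \<C>"
proof -
  interpret absolutely_closed_semigroup X f \<C> by fact
  show ?thesis
  proof
    show "semigroup_on Y g" by fact
    show "infinite (UNIV :: 'b set)" by (rule infinite_type)
    show "|Y| \<le>o |UNIV :: 'b set|"
      using ordLeq_transitive[OF card_of_image card_carrier] assms(4) by blast
    show "(T, k) \<in> \<C>" if "topological_semigroup T k" "Tychonoff_space T" for T k
      using that Tychonoff_in_class by blast
    have "closedin T (h ` Y)" if "(T, k) \<in> \<C>" "semigroup_hom Y g (topspace T) k h" for T k h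
    proof -
      have "semigroup_hom X f (topspace T) k (h \<circ> r)"
        using that(2) assms(3) by (auto simp: semigroup_hom_def Pi_iff)
      then have "closedin T ((h \<circ> r) ` X)"
        using that(1) closed_images unfolding absolutely_closed_def by fastforce
      then show ?thesis using assms(4) by (metis image_comp)
    qed
    then show "absolutely_closed \<C> Y g" by (auto simp: absolutely_closed_def)
  qed
qed

section \<open>Completeness of absolutely closed metric semigroups\<close>

locale absolutely_closed_metric_semigroup =
  absolutely_closed_semigroup X f \<C> + metric_semigroup X f d
  for X :: "'a set" and f and \<C> :: "('b topology \<times> ('b \<Rightarrow> 'b \<Rightarrow> 'b)) set" and d
begin

text \<open>The Cauchy sequences with the limit distance form a pseudometric semigroup containing \<open>X\<close>
  densely, and \<open>X\<close> is closed in its metric quotient.\<close>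

lemma complete: "mcomplete"
  unfolding mcomplete_def
proof (intro allI impI)
  fix s assume s: "MCauchy s"
  define Z where "Z = {s. MCauchy s}"
  define m where "m = (\<lambda>s t (n::nat). f (s n) (t n))"
  define e where "e = (\<lambda>s t :: nat \<Rightarrow> 'a. lim (\<lambda>n. d (s n) (t n)))"
  have in_X: "u n \<in> X" if "u \<in> Z" for u n
    using that by (auto simp: Z_def MCauchy_def)
  have close: "\<exists>N. \<forall>n\<ge>N. \<forall>k\<ge>N. d (u n) (u k) < r" if "u \<in> Z" "r > 0" for u r
    using that by (auto simp: Z_def MCauchy_def)
  have lim: "(\<lambda>n. d (u n) (v n)) \<longlonglongrightarrow> e u v" if uv: "u \<in> Z" "v \<in> Z" for u v
  proof -
    have "Cauchy (\<lambda>n. d (u n) (v n))"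
    proof (rule metric_CauchyI)
      fix r :: real assume "r > 0"
      then have "r / 2 > 0" by simp
      then obtain N N' where "\<forall>n\<ge>N. \<forall>k\<ge>N. d (u n) (u k) < r / 2"
        "\<forall>n\<ge>N'. \<forall>k\<ge>N'. d (v n) (v k) < r / 2"
        using close[OF uv(1)] close[OF uv(2)] by meson
      then have N: "n \<ge> N \<Longrightarrow> k \<ge> N \<Longrightarrow> d (u n) (u k) < r / 2"
        "n \<ge> N' \<Longrightarrow> k \<ge> N' \<Longrightarrow> d (v n) (v k) < r / 2" for n k
        by auto
      have "dist (d (u n) (v n)) (d (u k) (v k)) < r" if "n \<ge> max N N'" "k \<ge> max N N'" for n k
      proof -
        have "d (u n) (v n) \<le> d (u n) (u k) + d (u k) (v k) + d (v k) (v n)"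
          "d (u k) (v k) \<le> d (u k) (u n) + d (u n) (v n) + d (v n) (v k)"
          using in_X uv by (smt (verit) triangle)+
        then show ?thesis
          using N(1)[of n k] N(2)[of n k] N(1)[of k n] N(2)[of k n] that by (auto simp: dist_real_def)
      qed
      then show "\<exists>M. \<forall>n\<ge>M. \<forall>k\<ge>M. dist (d (u n) (v n)) (d (u k) (v k)) < r" by blast
    qed
    then show ?thesis unfolding e_def by (simp add: Cauchy_convergent_iff convergent_LIMSEQ_iff)
  qed
  have m_closed: "m u v \<in> Z" if uv: "u \<in> Z" "v \<in> Z" for u v
    unfolding Z_def MCauchy_def
  proof (intro CollectI conjI allI impI)
    show "range (m u v) \<subseteq> X" using in_X uv by (auto simp: m_def)
    fix r :: real assume "r > 0"
    then have "r / 2 > 0" by simp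
    then obtain N N' where "\<forall>n\<ge>N. \<forall>k\<ge>N. d (u n) (u k) < r / 2"
      "\<forall>n\<ge>N'. \<forall>k\<ge>N'. d (v n) (v k) < r / 2"
      using close[OF uv(1)] close[OF uv(2)] by meson
    then have N: "n \<ge> N \<Longrightarrow> k \<ge> N \<Longrightarrow> d (u n) (u k) < r / 2"
      "n \<ge> N' \<Longrightarrow> k \<ge> N' \<Longrightarrow> d (v n) (v k) < r / 2" for n k
      by auto
    have "d (m u v n) (m u v k) < r" if "n \<ge> max N N'" "k \<ge> max N N'" for n k
      using dist_mult[of "u n" "v n" "u k" "v k"] N(1)[of n k] N(2)[of n k] that in_X uv
      by (auto simp: m_def)
    then show "\<exists>N. \<forall>n n'. N \<le> n \<longrightarrow> N \<le> n' \<longrightarrow> d (m u v n) (m u v n') < r" by blast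
  qed
  interpret Z: pseudometric_semigroup Z m e
  proof
    show "semigroup_on Z m"
      using m_closed in_X by (auto simp: semigroup_on_def m_def mult_assoc)
    show "0 \<le> e x y" if "x \<in> Z" "y \<in> Z" for x y
      using LIMSEQ_le_const[OF lim[OF that]] by auto
    show "e x x = 0" if "x \<in> Z" for x
      using in_X[OF that] by (simp add: e_def)
    show "e x y = e y x" if "x \<in> Z" "y \<in> Z" for x y
      by (simp add: e_def commute)
    show "e x z \<le> e x y + e y z" if "x \<in> Z" "y \<in> Z" "z \<in> Z" for x y z
      using that in_X by (intro LIMSEQ_le[OF lim tendsto_add[OF lim lim]]) (auto intro!: triangle)
    show "e (m a x) (m a y) \<le> e x y" "e (m x a) (m y a) \<le> e x y"
      if "a \<in> Z" "x \<in> Z" "y \<in> Z" for a x y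
      using that in_X m_closed
      by (intro LIMSEQ_le[OF lim lim]; simp add: m_def left_subinvariant right_subinvariant)+
  qed
  interpret Y: metric_semigroup Z.quotient_carrier Z.quotient_mult Z.quotient_dist
    by (rule Z.quotient_metric_semigroup)
  define h where "h = (\<lambda>x. Z.representative (\<lambda>_. x))"
  have const: "(\<lambda>_. x) \<in> Z" if "x \<in> X" for x
    using that by (auto simp: Z_def MCauchy_def)
  have "h (f x y) = Z.quotient_mult (h x) (h y)" if "x \<in> X" "y \<in> X" for x y
    using Z.representative_mult[OF const[OF that(1)] const[OF that(2)]] by (simp add: h_def m_def)
  then have "semigroup_hom X f (topspace Y.mtopology) Z.quotient_mult h"
    unfolding semigroup_hom_def Y.topspace_mtopology
    using const by (auto simp: Z.quotient_carrier_def h_def)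
  then have closed: "closedin Y.mtopology (h ` X)"
    by (rule closedin_image[OF Y.topological_semigroup_mtopology
          metrizable_imp_completely_regular_space[OF Y.metrizable_space_mtopology]
          Y.Hausdorff_space_mtopology])
  have sZ: "s \<in> Z" using s by (simp add: Z_def)
  \<comment> \<open>The classes of the constant sequences with values \<open>s N\<close> approach
    the class of s and lie in a closed set. So s is at distance zero from a constant sequence, whose
    value is the limit.\<close>
  have "Z.representative s \<in> h ` X"
  proof (rule ccontr)
    assume "Z.representative s \<notin> h ` X"
    moreover have "Z.representative s \<in> Z.quotient_carrier"
      using sZ by (simp add: Z.quotient_carrier_def)
    ultimately obtain r where r: "r > 0" "disjnt (h ` X) (Y.mball (Z.representative s) r)"
      using closed unfolding Y.closedin_metric by blast
    obtain N where N: "\<forall>n\<ge>N. \<forall>k\<ge>N. d (s n) (s k) < r / 2"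
      using close[OF sZ, of "r / 2"] r by auto
    have "e s (\<lambda>_. s N) \<le> r / 2"
      using N sZ in_X const by (intro LIMSEQ_le_const2[OF lim]) (auto intro!: exI[of _ N] less_imp_le)
    then have "h (s N) \<in> Y.mball (Z.representative s) r"
      using r const[OF in_X[OF sZ]] sZ unfolding Y.in_mball h_def
      by (simp add: Z.quotient_dist_representative) (simp add: Z.quotient_carrier_def)
    then show False using r(2) in_X[OF sZ, of N] unfolding disjnt_def by blast
  qed
  then obtain x where x: "x \<in> X" "Z.representative s = Z.representative (\<lambda>_. x)"
    by (auto simp: h_def)
  then have "e s (\<lambda>_. x) = 0" using sZ const Z.representative_eq_iff by blast
  then have "(\<lambda>n. d (s n) x) \<longlonglongrightarrow> 0" using lim[OF sZ const[OF x(1)]] by simp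
  then show "\<exists>x. limitin mtopology s x sequentially"
    using x(1) in_X[OF sZ] by (intro exI[of _ x]) (auto simp: limitin_metric_dist_null)
qed

end

section \<open>Covers by few algebraic sets\<close>

lemma card_of_nat_ordLess_real: "|UNIV :: nat set| <o |UNIV :: real set|"
proof -
  have "\<not> |UNIV :: real set| \<le>o |UNIV :: nat set|"
    using uncountable_UNIV_real by (auto simp: countable_def card_of_ordLeq[symmetric])
  then show ?thesis by (simp add: not_ordLeq_iff_ordLess card_of_Well_order)
qed

text \<open>Counts the equations to be avoided at one stage of a transfinite choice: A is the
  initial segment below b, and g gives the earlier choices.\<close>

lemma card_of_patterns_ordLess:
  fixes K :: "'k set"
  assumes A: "|A| <o |K|" and K: "|UNIV :: nat set| <o |K|"
  shows "|patterns (insert b A \<union> g ` A) \<times> (insert b A \<union> g ` A)| <o |K|"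
proof -
  \<comment> \<open>Adding the naturals makes the bound infinite even for finite A; it stays below K
    because K is uncountable.\<close>
  define B where "B = A <+> (UNIV :: nat set)"
  have "infinite K" using K ordLess_imp_ordLeq infinite_iff_card_of_nat by blast
  then have B: "|B| <o |K|"
    unfolding B_def using A K card_of_Plus_ordLess_infinite by blast
  have inf: "infinite B" unfolding B_def by (simp add: finite_Plus_iff)
  then have ne: "B \<noteq> {}" by auto
  have AB: "|A| \<le>o |B|" unfolding B_def by (rule card_of_Plus1)
  have un: "|C \<union> D| \<le>o |B|" if "|C| \<le>o |B|" "|D| \<le>o |B|" for C D :: "'c set"
    using that inf by (intro card_of_Un_ordLeq_infinite_Field)
      (simp_all add: Field_card_of card_of_card_order_on)
  let ?S = "insert b A \<union> g ` A"
  have "|{b} \<union> A| \<le>o |B|" using AB ne by (intro un card_of_singl_ordLeq) auto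
  then have S: "|?S| \<le>o |B|"
    using un[of "insert b A" "g ` A"] ordLeq_transitive[OF card_of_image AB]
    by (metis insert_is_Un)
  have "|{None} \<union> Some ` ?S| \<le>o |B|"
    using ne ordLeq_transitive[OF card_of_image S] by (intro un card_of_singl_ordLeq) auto
  then have "|lists (insert None (Some ` ?S))| \<le>o |B|"
    using inf by (intro card_of_lists_ordLeq) (simp_all add: insert_commute)
  moreover have "|patterns ?S| \<le>o |lists (insert None (Some ` ?S))|"
    by (rule card_of_mono1) (auto simp: patterns_def)
  ultimately have "|patterns ?S| \<le>o |B|" by (metis (no_types) ordLeq_transitive)
  then have "|patterns ?S \<times> ?S| \<le>o |B|"
    using S inf by (intro card_of_Times_ordLeq_infinite_Field)
      (simp_all add: Field_card_of card_of_card_order_on)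
  then show ?thesis using B by (rule ordLeq_ordLess_trans)
qed

context absolutely_closed_semigroup
begin

text \<open>Otherwise choose, along a well-order of \<open>X\<close> whose proper initial segments are small, points
  \<open>x\<^sub>\<beta>\<close> that satisfy no equation over the elements up to \<open>\<beta>\<close> and the earlier points. The products
  in which \<open>x\<^sub>\<beta>\<close>, \<open>\<beta> \<ge> \<alpha>\<close>, is the largest letter then form a neighbourhood base of zero.\<close>

lemma covered_by_few_algebraic_sets:
  fixes K :: "'k set"
  assumes K: "|UNIV :: nat set| <o |K|" and XK: "|X| \<le>o |K|"
  shows "\<exists>\<P> \<subseteq> patterns X \<times> X. |\<P>| <o |K| \<and> (\<forall>x\<in>X. \<exists>(w, b)\<in>\<P>. pattern_value f w x = b)"
proof (rule ccontr)
  assume no_cover: "\<not> ?thesis"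
  define r where "r = |X|"
  have card_r: "Card_order r" and field: "Field r = X"
    by (simp_all add: r_def card_of_card_order_on Field_card_of)
  then have wo: "well_order_on X r"
    by (metis card_order_on_def card_order_on_Card_order)
  have lin: "(a, b) \<in> r \<or> (b, a) \<in> r" if "a \<in> X" "b \<in> X" for a b
    using wo that unfolding well_order_on_def linear_order_on_def partial_order_on_def
      preorder_on_def total_on_def refl_on_def by metis
  have refl: "(a, a) \<in> r" if "a \<in> X" for a using lin that by blast
  have trans: "(a, c) \<in> r" if "(a, b) \<in> r" "(b, c) \<in> r" for a b c
    using wo that unfolding well_order_on_def linear_order_on_def partial_order_on_def
      preorder_on_def trans_def by blast
  have antisym: "a = b" if "(a, b) \<in> r" "(b, a) \<in> r" for a b
    using wo that unfolding well_order_on_def linear_order_on_def partial_order_on_def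
      antisym_def by blast
  have in_X: "a \<in> X" "b \<in> X" if "(a, b) \<in> r" for a b
    using that field by (auto simp: Field_def)
  define S where "S g \<beta> = insert \<beta> (underS r \<beta>) \<union> g ` underS r \<beta>" for g :: "'a \<Rightarrow> 'a" and \<beta>
  let ?P = "\<lambda>g \<beta> v. \<beta> \<in> X \<longrightarrow>
    v \<in> X \<and> (\<forall>w\<in>patterns (S g \<beta>). \<forall>s\<in>S g \<beta>. pattern_value f w v \<noteq> s)"
  have "\<exists>x. \<forall>\<beta>. ?P x \<beta> (x \<beta>)"
  proof (rule dependent_wf_choice)
    show "wf (r - Id)" using wo by (simp add: well_order_on_def)
    show "?P g \<beta> v = ?P g' \<beta> v" if "\<And>\<gamma>. (\<gamma>, \<beta>) \<in> r - Id \<Longrightarrow> g \<gamma> = g' \<gamma>" for g g' \<beta> v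
    proof -
      have "g ` underS r \<beta> = g' ` underS r \<beta>"
        using that by (intro image_cong) (auto simp: underS_def)
      then show ?thesis by (simp add: S_def)
    qed
    fix \<beta> and g :: "'a \<Rightarrow> 'a" assume g: "\<And>\<gamma>. (\<gamma>, \<beta>) \<in> r - Id \<Longrightarrow> ?P g \<gamma> (g \<gamma>)"
    show "\<exists>v. ?P g \<beta> v"
    proof (cases "\<beta> \<in> X")
      case True
      have "underS r \<beta> \<subseteq> X" "g ` underS r \<beta> \<subseteq> X"
        using g in_X by (auto simp: underS_def)
      then have SX: "S g \<beta> \<subseteq> X" using True by (auto simp: S_def)
      \<comment> \<open>As r is a cardinal order, proper initial segments are smaller than X, hence
        than K; so the equations over S are too few to cover X.\<close>
      have "|underS r \<beta>| <o |K|"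
        using card_of_underS[OF card_r] True field XK ordLess_ordLeq_trans unfolding r_def by blast
      then have "|patterns (S g \<beta>) \<times> S g \<beta>| <o |K|"
        unfolding S_def using K by (rule card_of_patterns_ordLess)
      moreover have "patterns (S g \<beta>) \<times> S g \<beta> \<subseteq> patterns X \<times> X"
        using SX patterns_mono[OF SX] by blast
      ultimately obtain v where "v \<in> X"
        "\<not> (\<exists>(w, b)\<in>patterns (S g \<beta>) \<times> S g \<beta>. pattern_value f w v = b)"
        using no_cover by blast
      then show ?thesis by (intro exI[of _ v]) auto
    qed auto
  qed
  then obtain x where x: "\<And>\<beta>. \<beta> \<in> X \<Longrightarrow> x \<beta> \<in> X"
    "\<And>\<beta> w s. \<beta> \<in> X \<Longrightarrow> w \<in> patterns (S x \<beta>) \<Longrightarrow> s \<in> S x \<beta> \<Longrightarrow> pattern_value f w (x \<beta>) \<noteq> s"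
    by metis
  define L where "L \<beta> = insert (x \<beta>) (S x \<beta>)" for \<beta>
  have LX: "L \<beta> \<subseteq> X" if "\<beta> \<in> X" for \<beta>
    using that x(1) in_X by (auto simp: L_def S_def underS_def)
  have L_mono: "L \<beta> \<subseteq> L \<gamma>" if "(\<beta>, \<gamma>) \<in> r" for \<beta> \<gamma>
  proof (cases "\<beta> = \<gamma>")
    case False
    then have "\<beta> \<in> underS r \<gamma>" "underS r \<beta> \<subseteq> underS r \<gamma>"
      using that trans antisym by (auto simp: underS_def)
    then show ?thesis by (auto simp: L_def S_def)
  qed simp
  define W where "W \<beta> = {u \<in> lists (L \<beta>). x \<beta> \<in> set u}" for \<beta>
  define U where "U \<alpha> = {list_product f u |u \<beta>. (\<alpha>, \<beta>) \<in> r \<and> u \<in> W \<beta>}" for \<alpha>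
  have W_lists: "u \<in> lists X \<and> u \<noteq> []" if "u \<in> W \<beta>" "(\<alpha>, \<beta>) \<in> r" for u \<alpha> \<beta>
    using that in_X[OF that(2)] lists_mono[OF LX] by (auto simp: W_def)
  have W_append: "u @ v \<in> W \<gamma>" if "u \<in> lists (L \<gamma>)" "v \<in> lists (L \<gamma>)" "u \<in> W \<gamma> \<or> v \<in> W \<gamma>" for u v \<gamma>
    using that by (auto simp: W_def)
  have U_X: "U \<alpha> \<subseteq> X" for \<alpha>
    using W_lists list_product_closed by (force simp: U_def)
  have U_mono: "U \<gamma> \<subseteq> U \<alpha>" if "(\<alpha>, \<gamma>) \<in> r" for \<alpha> \<gamma>
    using trans[OF that] by (auto simp: U_def)
  have "\<Inter> (U ` X) \<noteq> {}"
  proof (rule zero_neighbourhoods_have_common_point)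
    have "X \<noteq> {}"
    proof
      assume "X = {}"
      moreover have "|{} :: ('a option list \<times> 'a) set| <o |K|"
        using ordLeq_ordLess_trans[OF card_of_empty K] .
      ultimately show False using no_cover by (auto intro!: exI[of _ "{}"])
    qed
    then show "U ` X \<noteq> {}" by simp
    show "V \<subseteq> X" if "V \<in> U ` X" for V using that U_X by auto
    show "V \<noteq> {}" if V: "V \<in> U ` X" for V
    proof -
      obtain \<alpha> where \<alpha>: "V = U \<alpha>" "\<alpha> \<in> X" using V by blast
      have "[x \<alpha>] \<in> W \<alpha>" by (simp add: W_def L_def)
      then show ?thesis using \<alpha> refl by (auto simp: U_def)
    qed
    show "\<exists>V''\<in>U ` X. V'' \<subseteq> V \<inter> V'" if V: "V \<in> U ` X" "V' \<in> U ` X" for V V'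
    proof -
      obtain \<alpha> \<gamma> where "V = U \<alpha>" "\<alpha> \<in> X" "V' = U \<gamma>" "\<gamma> \<in> X" using V by blast
      then show ?thesis using lin[of \<alpha> \<gamma>] U_mono by blast
    qed
    show "\<exists>V'\<in>U ` X. \<forall>y\<in>V'. \<forall>z\<in>V'. f y z \<in> V" if V: "V \<in> U ` X" for V
    proof (intro bexI ballI)
      fix y z assume yz: "y \<in> V" "z \<in> V"
      obtain \<alpha> where \<alpha>: "V = U \<alpha>" using V by blast
      then obtain u \<beta> v \<gamma> where u: "y = list_product f u" "(\<alpha>, \<beta>) \<in> r" "u \<in> W \<beta>"
        and v: "z = list_product f v" "(\<alpha>, \<gamma>) \<in> r" "v \<in> W \<gamma>"
        using yz by (auto simp: U_def)
      \<comment> \<open>Of the two largest letters, the one with the later index is the largest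
        letter of the concatenation.\<close>
      have "\<exists>\<delta>. (\<alpha>, \<delta>) \<in> r \<and> u @ v \<in> W \<delta>"
      proof (cases "(\<beta>, \<gamma>) \<in> r")
        case True
        have "u \<in> lists (L \<gamma>)" using u(3) lists_mono[OF L_mono[OF True]] by (auto simp: W_def)
        then show ?thesis using v W_append by (auto simp: W_def)
      next
        case False
        then have "(\<gamma>, \<beta>) \<in> r" using lin in_X u(2) v(2) by blast
        then have "v \<in> lists (L \<beta>)" using v(3) lists_mono[OF L_mono] by (auto simp: W_def)
        then show ?thesis using u W_append by (auto simp: W_def)
      qed
      moreover have "f y z = list_product f (u @ v)"
        using W_lists u v by (simp add: list_product_append)
      ultimately show "f y z \<in> V" unfolding \<alpha> U_def by blast
    qed (use V in auto)
    show "\<exists>V'\<in>U ` X. \<forall>z\<in>V'. f a z \<in> V \<and> f z a \<in> V" if V: "V \<in> U ` X" and a: "a \<in> X" for V a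
    proof -
      obtain \<alpha> where \<alpha>: "V = U \<alpha>" "\<alpha> \<in> X" using V by blast
      \<comment> \<open>Beyond both \<alpha> and a, the element a is an admissible letter of every
        word.\<close>
      obtain \<gamma> where \<gamma>: "\<gamma> \<in> X" "(\<alpha>, \<gamma>) \<in> r" "(a, \<gamma>) \<in> r"
        using lin[OF \<alpha>(2) a] refl \<alpha>(2) a by blast
      have "f a z \<in> V \<and> f z a \<in> V" if z: "z \<in> U \<gamma>" for z
      proof -
        obtain u \<beta> where u: "z = list_product f u" "(\<gamma>, \<beta>) \<in> r" "u \<in> W \<beta>"
          using z by (auto simp: U_def)
        have "(a, \<beta>) \<in> r" using trans \<gamma> u by blast
        then have "a \<in> L \<beta>" by (auto simp: L_def S_def underS_def)
        then have "[a] @ u \<in> W \<beta>" "u @ [a] \<in> W \<beta>"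
          using u(3) W_append by (auto simp: W_def)
        moreover have "f a z = list_product f ([a] @ u)" "f z a = list_product f (u @ [a])"
          using W_lists[OF u(3,2)] a u(1) list_product_append[of "[a]" u] list_product_append[of u "[a]"]
          by auto
        moreover have "(\<alpha>, \<beta>) \<in> r" using trans \<gamma>(2) u(2) by blast
        ultimately show ?thesis unfolding \<alpha>(1) U_def by blast
      qed
      then show ?thesis using \<gamma>(1) by blast
    qed
  qed
  then obtain c where c: "\<And>\<alpha>. \<alpha> \<in> X \<Longrightarrow> c \<in> U \<alpha>" by blast
  have "X \<noteq> {}" using no_cover ordLeq_ordLess_trans[OF card_of_empty K] by blast
  then have "c \<in> X" using c U_X by blast
  \<comment> \<open>The index c itself is used: then c belongs to S at \<beta>, and u turns into an
    equation over S with right-hand side c that \<open>x \<beta>\<close> satisfies.\<close>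
  then obtain u \<beta> where u: "c = list_product f u" "(c, \<beta>) \<in> r" "u \<in> W \<beta>"
    using c by (force simp: U_def)
  then have "abstract_letter (x \<beta>) u \<in> patterns (S x \<beta>)"
    by (intro abstract_letter_in_patterns) (auto simp: W_def L_def)
  moreover have "c \<in> S x \<beta>" using u(2) by (auto simp: S_def underS_def)
  ultimately have "pattern_value f (abstract_letter (x \<beta>) u) (x \<beta>) \<noteq> c"
    using x(2) in_X(2)[OF u(2)] by blast
  then show False by (simp add: pattern_value_abstract_letter u(1))
qed

end

section \<open>Covers of complete separable metric spaces\<close>

text \<open>The binary digits of a real steer a nested sequence of balls: a run of \<open>j\<close> ones, ended by a
  zero, proposes the \<open>j\<close>-th ball of a countable base, which is accepted if it lies in the current
  one. A state consists of the centre, the radius and the length of the current run; the state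
  after \<open>n\<close> digits depends on \<open>k = \<lfloor>2\<^sup>n x\<rfloor>\<close> only.\<close>

primrec ball_state ::
  "('a \<Rightarrow> 'a \<Rightarrow> real) \<Rightarrow> (nat \<Rightarrow> 'a) \<Rightarrow> nat \<Rightarrow> int \<Rightarrow> 'a \<times> real \<times> nat" where
  "ball_state d e 0 k = (e 0, 1, 0)"
| "ball_state d e (Suc n) k =
     (case ball_state d e n (k div 2) of (c, r, j) \<Rightarrow>
        if odd k then (c, r, Suc j)
        else if d c (e (fst (prod_decode j))) + 1 / Suc (snd (prod_decode j)) < r
        then (e (fst (prod_decode j)), 1 / Suc (snd (prod_decode j)), 0)
        else (c, r, 0))"

lemma nowhere_dense_compl_open:
  assumes "open U" "closure U = UNIV"
  shows "nowhere_dense (- U)"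
  using assms by (simp add: nowhere_dense_def closure_complement interior_open interior_complement)

context Metric_space
begin

text \<open>Baire category with fewer than continuum many sets: the balls steered by a real outside of
  fewer than continuum many meager sets shrink to a point that avoids all the closed sets.\<close>

lemma ball_in_some_closed_set:
  assumes cov: "cov_meager =o |UNIV :: real set|"
    and complete: "mcomplete" and nonempty: "M \<noteq> {}"
    and e: "range e \<subseteq> M" and dense: "\<And>x \<delta>. x \<in> M \<Longrightarrow> \<delta> > 0 \<Longrightarrow> \<exists>i::nat. d (e i) x < \<delta>"
    and closed: "\<And>A. A \<in> \<A> \<Longrightarrow> closedin mtopology A"
    and card: "|\<A>| <o |UNIV :: real set|" and cover: "M \<subseteq> \<Union>\<A>"
  shows "\<exists>A\<in>\<A>. \<exists>q\<in>M. \<exists>\<epsilon>>0. mball q \<epsilon> \<subseteq> A"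
proof (rule ccontr)
  assume no_ball: "\<not> ?thesis"
  have eM: "e i \<in> M" for i using e by auto
  define c where "c n k = fst (ball_state d e n k)" for n k
  define r where "r n k = fst (snd (ball_state d e n k))" for n k
  define run where "run n k = snd (snd (ball_state d e n k))" for n k
  have state: "ball_state d e n k = (c n k, r n k, run n k)" for n k
    by (simp add: c_def r_def run_def)
  have "c n k \<in> M \<and> r n k > 0" for n k
  proof (induction n arbitrary: k)
    case (Suc n)
    obtain c' r' j where st: "ball_state d e n (k div 2) = (c', r', j)" by (metis prod_cases3)
    then have "c' \<in> M" "r' > 0" using Suc[of "k div 2"] by (auto simp: c_def r_def)
    then show ?case
      using eM by (simp_all add: c_def r_def st)
  qed (use eM in \<open>simp add: c_def r_def\<close>)
  then have cM: "c n k \<in> M" and r_pos: "r n k > 0" for n k by blast+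
  have nested: "d (c n (k div 2)) (c (Suc n) k) + r (Suc n) k \<le> r n (k div 2)" for n k
  proof -
    obtain c' r' j where st: "ball_state d e n (k div 2) = (c', r', j)" by (metis prod_cases3)
    then have "c n (k div 2) = c'" "r n (k div 2) = r'" "d c' c' = 0"
      using cM[of n "k div 2"] by (auto simp: c_def r_def)
    then show ?thesis by (simp add: c_def[of "Suc n"] r_def[of "Suc n"] st)
  qed
  \<comment> \<open>A digit zero ends the run whether or not the proposed ball is accepted, so a new
    proposal can start from any state.\<close>
  have even_step: "run (Suc n) (2 * k) = 0" for n k
    by (simp add: run_def split: prod.split)
  have feed: "\<exists>k'. k' div 2 ^ j = k \<and> c (n + j) k' = c n k \<and> r (n + j) k' = r n k \<and> run (n + j) k' = j"
    if "run n k = 0" for n k j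
  proof (induction j)
    case (Suc j)
    then obtain k' where k': "k' div 2 ^ j = k" "c (n + j) k' = c n k" "r (n + j) k' = r n k"
      "run (n + j) k' = j" by blast
    have "ball_state d e (Suc (n + j)) (2 * k' + 1) = (c n k, r n k, Suc j)"
      using k' by (simp add: state[of "n + j"])
    moreover have "(2 * k' + 1) div 2 ^ Suc j = k"
      using k'(1) by (simp add: div_mult2_eq[of _ 2 "2 ^ j"] zdiv_zmult2_eq)
    ultimately show ?case by (intro exI[of _ "2 * k' + 1"]) (simp add: c_def r_def run_def)
  qed (use that in auto)
  have refine: "\<exists>m k'. k' div 2 ^ m = k \<and> mcball (c (n + m) k') (r (n + m) k') \<inter> A = {} \<and>
      r (n + m) k' < 1 / Suc N" if A: "A \<in> \<A>" for A N n k
  proof -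
    \<comment> \<open>One zero resets the run; then j ones and a zero propose the ball with code
      j.\<close>
    let ?c = "c (Suc n) (2 * k)" and ?r = "r (Suc n) (2 * k)"
    obtain y where y: "y \<in> mball ?c ?r" "y \<notin> A"
      using no_ball A cM r_pos by blast
    then have "y \<in> M" by simp
    then obtain \<rho> where \<rho>: "\<rho> > 0" "disjnt A (mball y \<rho>)"
      using closed[OF A] y(2) by (auto simp: closedin_metric)
    \<comment> \<open>With centre \<delta>-close to y and radius below \<delta>, the new closed ball
      fits into the current ball, misses A and is as small as required.\<close>
    define \<delta> where "\<delta> = min ((?r - d ?c y) / 2) (min (\<rho> / 2) (1 / Suc N))"
    have \<delta>: "\<delta> > 0" "2 * \<delta> \<le> ?r - d ?c y" "2 * \<delta> \<le> \<rho>" "\<delta> \<le> 1 / Suc N"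
    proof -
      have "?r - d ?c y > 0" "1 / Suc N > (0 :: real)" using y(1) by simp_all
      then show "\<delta> > 0" using \<rho>(1) unfolding \<delta>_def by (simp del: of_nat_Suc)
      have "\<delta> \<le> (?r - d ?c y) / 2" unfolding \<delta>_def by (rule min.cobounded1)
      then show "2 * \<delta> \<le> ?r - d ?c y" by simp
      have *: "\<delta> \<le> min (\<rho> / 2) (1 / Suc N)" unfolding \<delta>_def by (rule min.cobounded2)
      then have "\<delta> \<le> \<rho> / 2" by (rule order_trans[OF _ min.cobounded1])
      then show "2 * \<delta> \<le> \<rho>" by simp
      show "\<delta> \<le> 1 / Suc N" using * by (rule order_trans[OF _ min.cobounded2])
    qed
    obtain i where i: "d (e i) y < \<delta>" using dense[OF \<open>y \<in> M\<close> \<delta>(1)] by blast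
    obtain l where l: "1 / Suc l < \<delta>" using \<delta>(1) nat_approx_posE by metis
    define j where "j = prod_encode (i, l)"
    obtain k' where k': "k' div 2 ^ j = 2 * k" "c (Suc n + j) k' = ?c" "r (Suc n + j) k' = ?r"
      "run (Suc n + j) k' = j"
      using feed[OF even_step] by blast
    have acc: "d ?c (e i) + 1 / Suc l < ?r"
      using triangle[of ?c y "e i"] cM eM \<open>y \<in> M\<close> i l \<delta>(2) commute[of y "e i"] by simp
    have new: "ball_state d e (Suc (Suc n + j)) (2 * k') = (e i, 1 / Suc l, 0)"
    proof -
      have "ball_state d e (Suc n + j) k' = (?c, ?r, j)" using k' state by metis
      moreover have "prod_decode j = (i, l)" by (simp add: j_def)
      ultimately show ?thesis using acc by (simp del: add_Suc)
    qed
    have "mcball (e i) (1 / Suc l) \<inter> A = {}"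
    proof -
      have "z \<in> mball y \<rho>" if "z \<in> mcball (e i) (1 / Suc l)" for z
        using that triangle[of y "e i" z] \<open>y \<in> M\<close> eM i l \<delta>(3) commute[of y "e i"] by auto
      then show ?thesis using \<rho>(2) unfolding disjnt_def by blast
    qed
    moreover have "(2 * k') div 2 ^ (Suc (Suc j)) = k"
    proof -
      have "(2 * k') div 2 ^ (Suc (Suc j)) = (2 * k') div (2 * (2 ^ j * 2))" by simp
      also have "\<dots> = k' div (2 ^ j * 2)" by (rule div_mult_mult1) simp
      also have "\<dots> = k' div 2 ^ j div 2" by (rule zdiv_zmult2_eq) simp
      finally show ?thesis using k'(1) by simp
    qed
    ultimately show ?thesis using new l \<delta>(4)
      by (intro exI[of _ "Suc (Suc j)"] exI[of _ "2 * k'"]) (simp add: c_def r_def)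
  qed
  \<comment> \<open>The open dyadic intervals whose digits steer to a small closed ball missing A;
    by \<open>refine\<close> there is one inside every dyadic interval.\<close>
  define G where "G A N = (\<Union>(n, k)\<in>{(n, k). mcball (c n k) (r n k) \<inter> A = {} \<and> r n k < 1 / Suc N}.
    {real_of_int k / 2 ^ n <..< (real_of_int k + 1) / 2 ^ n})" for A N
  have openG: "open (G A N)" for A N by (auto simp: G_def)
  have denseG: "closure (G A N) = UNIV" if A: "A \<in> \<A>" for A N
  proof -
    have "x \<in> closure (G A N)" for x
      unfolding closure_approachable
    proof (intro allI impI)
      fix \<epsilon> :: real assume "\<epsilon> > 0"
      then obtain n where n: "(1 / 2) ^ n < \<epsilon>"
        using real_arch_pow_inv[of \<epsilon> "1 / 2"] by auto
      define k where "k = \<lfloor>2 ^ n * x\<rfloor>"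
      obtain m k' where k': "k' div 2 ^ m = k" "mcball (c (n + m) k') (r (n + m) k') \<inter> A = {}"
        "r (n + m) k' < 1 / Suc N" using refine[OF A] by blast
      define y where "y = (real_of_int k' + 1 / 2) / 2 ^ (n + m)"
      have "y \<in> {real_of_int k' / 2 ^ (n + m) <..< (real_of_int k' + 1) / 2 ^ (n + m)}"
        by (auto simp: y_def divide_strict_right_mono)
      then have "y \<in> G A N" using k' unfolding G_def by blast
      \<comment> \<open>The dyadic interval of k' lies inside that of k, so x and y are at most 2^-n
        apart.\<close>
      have kk: "k * 2 ^ m \<le> k'" "k' + 1 \<le> (k + 1) * 2 ^ m"
      proof -
        have "k' = k * 2 ^ m + k' mod 2 ^ m" using k'(1) by (metis div_mult_mod_eq)
        moreover have "0 \<le> k' mod 2 ^ m" "k' mod 2 ^ m < 2 ^ m" by auto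
        ultimately have "k * 2 ^ m \<le> k'" "k' + 1 \<le> k * 2 ^ m + 2 ^ m" by linarith+
        then show "k * 2 ^ m \<le> k'" "k' + 1 \<le> (k + 1) * 2 ^ m" by (simp_all add: algebra_simps)
      qed
      have "real_of_int k * 2 ^ m \<le> real_of_int k'" "real_of_int k' + 1 \<le> (real_of_int k + 1) * 2 ^ m"
        using kk(1)[THEN of_int_le_iff[where 'a = real, THEN iffD2]]
          kk(2)[THEN of_int_le_iff[where 'a = real, THEN iffD2]] by simp_all
      moreover have "2 ^ n * y = (real_of_int k' + 1 / 2) / 2 ^ m"
        by (simp add: y_def power_add)
      ultimately have "real_of_int k \<le> 2 ^ n * y" "2 ^ n * y \<le> real_of_int k + 1"
        by (simp_all only: pos_le_divide_eq pos_divide_le_eq zero_less_power zero_less_numeral)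
      moreover have "real_of_int k \<le> 2 ^ n * x" "2 ^ n * x < real_of_int k + 1"
        by (auto simp: k_def)
      ultimately have "\<bar>2 ^ n * y - 2 ^ n * x\<bar> \<le> 1" by linarith
      then have "2 ^ n * dist y x \<le> 1" by (simp add: dist_real_def flip: right_diff_distrib abs_mult)
      then have "dist y x \<le> (1 / 2) ^ n" by (simp add: field_simps power_one_over)
      then show "\<exists>y\<in>G A N. dist y x < \<epsilon>" using n \<open>y \<in> G A N\<close> by (intro bexI[of _ y]) auto
    qed
    then show ?thesis by blast
  qed
  have "\<exists>x. \<forall>A\<in>\<A>. \<forall>N. x \<in> G A N"
  proof (rule ccontr)
    assume no: "\<not> ?thesis"
    \<comment> \<open>These complements are meager and there are at most |\<A>| of them, too few to
      cover the line.\<close>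
    define \<G> where "\<G> = (\<lambda>A. \<Union>N. - G A N) ` \<A>"
    have "meager (\<Union>N. - G A N)" if "A \<in> \<A>" for A
      unfolding meager_def using nowhere_dense_compl_open[OF openG denseG[OF that]]
      by (intro exI[of _ "range (\<lambda>N. - G A N)"]) auto
    moreover have "\<Union>\<G> = UNIV" using no by (auto simp: \<G>_def)
    ultimately have "meager_cover \<G>" by (auto simp: meager_cover_def \<G>_def)
    then have "cov_meager \<le>o |\<G>|" by (rule cov_meager_least)
    moreover have "|\<G>| \<le>o |\<A>|" unfolding \<G>_def by (rule card_of_image)
    ultimately have "cov_meager <o |UNIV :: real set|"
      using card ordLeq_ordLess_trans ordLeq_transitive by blast
    then show False using cov not_ordLess_ordIso by blast
  qed
  then obtain x where x: "\<And>A N. A \<in> \<A> \<Longrightarrow> x \<in> G A N" by blast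
  define K where "K n = \<lfloor>2 ^ n * x\<rfloor>" for n :: nat
  \<comment> \<open>Dropping the last digit of \<open>K (Suc n)\<close> gives \<open>K n\<close>, so
    the balls along x form one nested sequence.\<close>
  have K_Suc: "K (Suc n) div 2 = K n" for n
    using floor_divide_real_eq_div[of 2 "2 ^ Suc n * x"] by (simp add: K_def)
  have target: "\<exists>n. mcball (c n (K n)) (r n (K n)) \<inter> A = {} \<and> r n (K n) < 1 / Suc N"
    if A: "A \<in> \<A>" for A N
  proof -
    obtain n k where nk: "mcball (c n k) (r n k) \<inter> A = {}" "r n k < 1 / Suc N"
      "real_of_int k / 2 ^ n < x" "x < (real_of_int k + 1) / 2 ^ n"
      using x[OF A, of N] by (auto simp: G_def)
    then have "K n = k" unfolding K_def by (intro floor_unique) (auto simp: field_simps)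
    then show ?thesis using nk by blast
  qed
  have shrink: "d (c n (K n)) (c (n + m) (K (n + m))) + r (n + m) (K (n + m)) \<le> r n (K n)" for n m
  proof (induction m)
    case (Suc m)
    show ?case
      using Suc nested[of "n + m" "K (Suc (n + m))"] cM
        triangle[of "c n (K n)" "c (n + m) (K (n + m))" "c (Suc (n + m)) (K (Suc (n + m)))"]
      by (simp add: K_Suc)
  qed (use cM in auto)
  obtain A0 where A0: "A0 \<in> \<A>" using nonempty cover by blast
  define s where "s n = c n (K n)" for n
  have "MCauchy s"
    unfolding MCauchy_def
  proof (intro conjI allI impI)
    show "range s \<subseteq> M" using cM by (auto simp: s_def)
    fix \<epsilon> :: real assume "\<epsilon> > 0"
    then obtain N where N: "1 / Suc N < \<epsilon> / 2" using nat_approx_posE[of "\<epsilon> / 2"] by auto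
    obtain n where "r n (K n) < 1 / Suc N" using target[OF A0] by blast
    then have n: "d (s n) (s m) < \<epsilon> / 2" if "m \<ge> n" for m
      using shrink[of n "m - n"] r_pos[of m "K m"] that N by (simp add: s_def)
    have "d (s m) (s m') < \<epsilon>" if "m \<ge> n" "m' \<ge> n" for m m'
      using n[OF that(1)] n[OF that(2)] triangle[of "s m" "s n" "s m'"] commute[of "s m" "s n"] cM
      by (simp add: s_def)
    then show "\<exists>N. \<forall>n n'. N \<le> n \<longrightarrow> N \<le> n' \<longrightarrow> d (s n) (s n') < \<epsilon>" by blast
  qed
  then obtain y where y: "limitin mtopology s y sequentially"
    using complete by (auto simp: mcomplete_def)
  \<comment> \<open>Limits stay in closed balls only, which is why \<open>refine\<close> separates
    closed balls from A.\<close>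
  have y_ball: "y \<in> mcball (c n (K n)) (r n (K n))" for n
  proof (rule limitin_closedin[OF y])
    show "closedin mtopology (mcball (c n (K n)) (r n (K n)))" by (rule closedin_mcball)
    have "s m \<in> mcball (c n (K n)) (r n (K n))" if "m \<ge> n" for m
      using shrink[of n "m - n"] r_pos[of m "K m"] that cM by (simp add: s_def)
    then show "\<forall>\<^sub>F m in sequentially. s m \<in> mcball (c n (K n)) (r n (K n))"
      by (auto simp: eventually_sequentially)
  qed simp
  have "y \<notin> A" if "A \<in> \<A>" for A
    using target[OF that, of 0] y_ball by blast
  moreover have "y \<in> M" using y_ball[of 0] by simp
  ultimately show False using cover by blast
qed

end

section \<open>Closed ideals\<close>

context carrier_semigroup
begin

definition two_sided_ideal :: "'a set \<Rightarrow> bool" where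
  "two_sided_ideal I \<longleftrightarrow> I \<subseteq> X \<and> (\<forall>a\<in>X. \<forall>x\<in>I. f a x \<in> I \<and> f x a \<in> I)"

lemma list_product_in_ideal:
  assumes "two_sided_ideal I" "u \<in> lists X" "set u \<inter> I \<noteq> {}"
  shows "list_product f u \<in> I"
  using assms(2,3)
proof (induction u)
  case (Cons x u)
  show ?case
  proof (cases "u = []")
    case False
    then have "list_product f (x # u) = f x (list_product f u)" "list_product f u \<in> X"
    proof -
      show "list_product f u \<in> X" using list_product_closed[OF False Cons.hyps(2)] .
    qed (simp add: list_product_Cons False)
    then show ?thesis
      using Cons assms(1) by (auto simp: two_sided_ideal_def)
  qed (use Cons.prems in auto)
qed simp

text \<open>Right multiplication by a point q of the ideal sends X into the ideal, so substituting
  the pattern xq turns a cover of the ideal into one of X.\<close>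

lemma finitely_covered_ideal:
  assumes "two_sided_ideal I" "I \<noteq> {}" "finitely_covered I"
  shows "finitely_covered X"
proof -
  obtain q where q: "q \<in> I" "q \<in> X" using assms by (auto simp: two_sided_ideal_def)
  obtain \<P> where P: "finite \<P>" "\<P> \<subseteq> patterns X \<times> X"
    "\<And>x. x \<in> I \<Longrightarrow> \<exists>(w, b)\<in>\<P>. pattern_value f w x = b"
    using assms(3) by (auto simp: finitely_covered_def)
  let ?v = "[None, Some q]"
  have v: "?v \<in> patterns X" using q by (auto intro: patternsI)
  have val: "pattern_value f ?v x = f x q" for x by (simp add: pattern_value_def)
  let ?Q = "(\<lambda>(w, b). (pattern_comp w ?v, b)) ` \<P>"
  have "finite ?Q" "?Q \<subseteq> patterns X \<times> X"
    using P pattern_comp_in_patterns[OF _ v] by auto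
  moreover have "\<exists>(w, b)\<in>?Q. pattern_value f w x = b" if "x \<in> X" for x
  proof -
    have "f x q \<in> I" using assms(1) that q by (auto simp: two_sided_ideal_def)
    then obtain w b where wb: "(w, b) \<in> \<P>" "pattern_value f w (f x q) = b" using P(3) by blast
    then have "w \<in> patterns X" using P(2) by auto
    then have "pattern_value f (pattern_comp w ?v) x = b"
      using pattern_value_comp[OF _ v that] wb(2) val by simp
    then show ?thesis using wb(1) by force
  qed
  ultimately show ?thesis unfolding finitely_covered_def by (intro exI[of _ ?Q] conjI ballI)
qed

end

section \<open>Minimal closed ideals and locally constant polynomials\<close>

context absolutely_closed_metric_semigroup
begin

text \<open>A nonempty chain of closed ideals meets the conditions of
  \<open>zero_neighbourhoods_have_common_point\<close>, since ideals absorb products; so its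
  intersection is a nonempty lower bound.\<close>

lemma minimal_closed_ideal:
  assumes "X \<noteq> {}"
  obtains M where "M \<noteq> {}" "two_sided_ideal M" "closedin mtopology M"
    "\<And>N. N \<noteq> {} \<Longrightarrow> two_sided_ideal N \<Longrightarrow> closedin mtopology N \<Longrightarrow> N \<subseteq> M \<Longrightarrow> N = M"
proof -
  define \<I> where "\<I> = {I. I \<noteq> {} \<and> two_sided_ideal I \<and> closedin mtopology I}"
  have sub: "I \<subseteq> X" if "I \<in> \<I>" for I using that by (auto simp: \<I>_def two_sided_ideal_def)
  \<comment> \<open>\<open>subset_Zorn\<close> yields maximal sets, so it is applied to the
    complements of the ideals.\<close>
  have "\<exists>U\<in>(\<lambda>I. X - I) ` \<I>. \<forall>V\<in>C. V \<subseteq> U" if C: "subset.chain ((\<lambda>I. X - I) ` \<I>) C" for C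
  proof -
    define D where "D = (\<lambda>V. X - V) ` C"
    have CI: "C \<subseteq> (\<lambda>I. X - I) ` \<I>" using C by (simp add: subset.chain_def)
    then have DI: "D \<subseteq> \<I>" using sub by (force simp: D_def double_diff)
    show ?thesis
    proof (cases "C = {}")
      case True
      have "X \<in> \<I>" using assms by (auto simp: \<I>_def two_sided_ideal_def)
      then show ?thesis using True by blast
    next
      case False
      have "V \<subseteq> V' \<or> V' \<subseteq> V" if "V \<in> C" "V' \<in> C" for V V'
        using C that unfolding subset.chain_def by blast
      then have chain: "I \<subseteq> J \<or> J \<subseteq> I" if "I \<in> D" "J \<in> D" for I J
        using that unfolding D_def by auto
      have ideal: "I \<noteq> {}" "two_sided_ideal I" "closedin mtopology I" if "I \<in> D" for I
        using that DI by (auto simp: \<I>_def)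
      have "\<Inter>D \<noteq> {}"
      proof (rule zero_neighbourhoods_have_common_point)
        show "D \<noteq> {}" using False by (simp add: D_def)
        show "I \<subseteq> X" if "I \<in> D" for I using ideal(2)[OF that] by (simp add: two_sided_ideal_def)
        show "I \<noteq> {}" if "I \<in> D" for I using ideal(1)[OF that] .
        show "\<exists>W\<in>D. W \<subseteq> I \<inter> J" if "I \<in> D" "J \<in> D" for I J using chain[OF that] that by blast
        show "\<exists>V\<in>D. \<forall>x\<in>V. \<forall>y\<in>V. f x y \<in> I" if "I \<in> D" for I
          using ideal(2)[OF that] that by (auto simp: two_sided_ideal_def)
        show "\<exists>V\<in>D. \<forall>x\<in>V. f a x \<in> I \<and> f x a \<in> I" if "I \<in> D" "a \<in> X" for I a
          using ideal(2)[OF that(1)] that by (auto simp: two_sided_ideal_def)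
      qed
      moreover have "two_sided_ideal (\<Inter>D)"
      proof -
        obtain I where "I \<in> D" using False by (auto simp: D_def)
        then have "\<Inter>D \<subseteq> X" using ideal(2)[of I] by (auto simp: two_sided_ideal_def)
        then show ?thesis using ideal(2) by (auto simp: two_sided_ideal_def)
      qed
      moreover have "closedin mtopology (\<Inter>D)"
        using ideal(3) False by (intro closedin_Inter) (auto simp: D_def)
      ultimately have "\<Inter>D \<in> \<I>" by (simp add: \<I>_def)
      moreover have "V \<subseteq> X - \<Inter>D" if "V \<in> C" for V
        using that CI by (auto simp: D_def)
      ultimately show ?thesis by blast
    qed
  qed
  from subset_Zorn[OF this] obtain M where M: "M \<in> \<I>"
    "\<And>N. N \<in> \<I> \<Longrightarrow> X - M \<subseteq> X - N \<Longrightarrow> X - N = X - M" by auto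
  have "N = M" if "N \<in> \<I>" "N \<subseteq> M" for N
    using M(2)[OF that(1)] sub[OF that(1)] sub[OF M(1)] that(2) by blast
  then show thesis using M(1) by (intro that[of M]) (simp_all add: \<I>_def)
qed

text \<open>Since a polynomial is constant near every point of \<open>M\<close>, avoiding small balls of \<open>M\<close> costs only
  finitely many algebraic sets. So one can choose a sequence \<open>x\<^sub>k\<close> in \<open>M\<close> such that \<open>2\<^sup>-\<^sup>m\<close>-neighbourhoods
  of products with largest letter \<open>x\<^sub>k\<close>, \<open>k \<ge> m\<close>, form a neighbourhood base of zero. The length bound
  \<open>2\<^sup>k\<^sup>-\<^sup>m\<close> leaves room for doubling the length when \<open>m\<close> decreases by one.\<close>

lemma locally_constant_imp_finitely_covered:
  assumes M: "two_sided_ideal M" "M \<noteq> {}"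
    and e: "range e \<subseteq> X" and dense: "\<And>x \<delta>. x \<in> X \<Longrightarrow> \<delta> > 0 \<Longrightarrow> \<exists>i::nat. d (e i) x < \<delta>"
    and const: "\<And>b. b \<in> M \<Longrightarrow>
      \<exists>w\<in>patterns X. \<exists>c\<in>X. \<exists>\<epsilon>>0. \<forall>x\<in>M. d b x < \<epsilon> \<longrightarrow> pattern_value f w x = c"
  shows "finitely_covered X"
proof (rule ccontr)
  assume "\<not> finitely_covered X"
  then have no_cover: "\<not> finitely_covered M" using finitely_covered_ideal M by blast
  have MX: "M \<subseteq> X" using M by (simp add: two_sided_ideal_def)
  have eX: "e i \<in> X" for i using e by auto
  \<comment> \<open>The traces on M of a countable base of balls; i encodes centre and
    radius.\<close>
  define B where "B i = {x \<in> M. d (e (fst (prod_decode i))) x < 1 / Suc (snd (prod_decode i))}" for i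
  define good where "good i \<longleftrightarrow> (\<exists>w\<in>patterns X. \<exists>c\<in>X. \<forall>x\<in>B i. pattern_value f w x = c)" for i
  have good_cover: "\<exists>i. good i \<and> b \<in> B i" if b: "b \<in> M" for b
  proof -
    obtain w c \<epsilon> where wc: "w \<in> patterns X" "c \<in> X" "\<epsilon> > 0"
      "\<And>x. x \<in> M \<Longrightarrow> d b x < \<epsilon> \<Longrightarrow> pattern_value f w x = c"
      using const[OF b] by blast
    obtain n where n: "1 / Suc n < \<epsilon> / 2" using nat_approx_posE[of "\<epsilon> / 2"] wc(3) by auto
    obtain j where j: "d (e j) b < 1 / Suc n" using dense[of b "1 / Suc n"] b MX by auto
    let ?i = "prod_encode (j, n)"
    have "pattern_value f w x = c" if "x \<in> B ?i" for x
    proof (rule wc(4))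
      show "x \<in> M" using that by (simp add: B_def)
      then have "d b x \<le> d b (e j) + d (e j) x" using triangle eX b MX by blast
      moreover have "d (e j) x < 1 / Suc n" using that by (simp add: B_def)
      ultimately show "d b x < \<epsilon>" using j n commute[of b "e j"] by linarith
    qed
    then show ?thesis using wc(1,2) j b by (intro exI[of _ ?i]) (auto simp: good_def B_def)
  qed
  \<comment> \<open>Finitely many letters and a length bound leave finitely many words at stage
    k.\<close>
  define S where "S g k = e ` {..k} \<union> g ` {..<k}" for g k
  define W where "W g k = {w \<in> patterns (S g k). length w \<le> 2 ^ k}" for g k
  let ?P = "\<lambda>g k v. v \<in> M \<and> (\<forall>w\<in>W g k. \<forall>i\<le>k. good i \<longrightarrow> pattern_value f w v \<notin> B i)"
  have "\<exists>x. \<forall>k. ?P x k (x k)"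
  proof (rule dependent_wellorder_choice)
    fix v and g h :: "nat \<Rightarrow> 'a" and k assume "\<And>l. l < k \<Longrightarrow> g l = h l"
    then have "S g k = S h k" by (auto simp: S_def)
    then show "?P g k v = ?P h k v" by (simp add: W_def)
  next
    fix k and g :: "nat \<Rightarrow> 'a" assume g: "\<And>l. l < k \<Longrightarrow> ?P g l (g l)"
    have SX: "S g k \<subseteq> X" using g eX MX by (auto simp: S_def)
    have "finite {w. set w \<subseteq> insert None (Some ` S g k) \<and> length w \<le> 2 ^ k}"
      by (rule finite_lists_length_le) (simp add: S_def)
    then have finW: "finite (W g k)"
      by (rule rev_finite_subset) (auto simp: W_def patterns_def)
    show "\<exists>v. ?P g k v"
    proof (rule ccontr)
      assume no: "\<not> ?thesis"
      have "\<exists>q. good i \<longrightarrow> fst q \<in> patterns X \<and> snd q \<in> X \<and>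
        (\<forall>x\<in>B i. pattern_value f (fst q) x = snd q)" for i
        unfolding good_def by auto
      then obtain q where q: "\<And>i. good i \<longrightarrow> fst (q i) \<in> patterns X \<and> snd (q i) \<in> X \<and>
        (\<forall>x\<in>B i. pattern_value f (fst (q i)) x = snd (q i))" by metis
      define p c where "p i = fst (q i)" and "c i = snd (q i)" for i
      have pc: "good i \<Longrightarrow> p i \<in> patterns X" "good i \<Longrightarrow> c i \<in> X"
        "good i \<Longrightarrow> x \<in> B i \<Longrightarrow> pattern_value f (p i) x = c i" for i x
        using q[of i] by (auto simp: p_def c_def)
      \<comment> \<open>If w takes v into the good set \<open>B i\<close>, then \<open>p i\<close>
        composed with w has the value \<open>c i\<close> at v. So one equation per pair (w, i)
        suffices.\<close>
      define \<P> where "\<P> = (\<lambda>(w, i). (pattern_comp (p i) w, c i)) ` (W g k \<times> {i. i \<le> k \<and> good i})"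
      have "finite \<P>" using finW by (simp add: \<P>_def)
      have WX: "w \<in> patterns X" if "w \<in> W g k" for w
        using that patterns_mono[OF SX] by (auto simp: W_def)
      then have "\<P> \<subseteq> patterns X \<times> X"
        using pc(1,2) pattern_comp_in_patterns[OF pc(1) WX] by (auto simp: \<P>_def)
      moreover have "\<exists>(w, b)\<in>\<P>. pattern_value f w v = b" if v: "v \<in> M" for v
      proof -
        obtain w i where wi: "w \<in> W g k" "i \<le> k" "good i" "pattern_value f w v \<in> B i"
          using no v by blast
        then have "pattern_value f (pattern_comp (p i) w) v = c i"
          using pattern_value_comp[OF pc(1) WX] pc(3) v MX by (metis subsetD)
        then show ?thesis using wi unfolding \<P>_def by force
      qed
      ultimately show False
        using no_cover \<open>finite \<P>\<close> unfolding finitely_covered_def by blast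
    qed
  qed
  then obtain x where x: "\<And>k. x k \<in> M"
    "\<And>k w i. w \<in> W x k \<Longrightarrow> i \<le> k \<Longrightarrow> good i \<Longrightarrow> pattern_value f w (x k) \<notin> B i"
    by metis
  define V where "V m k = {u \<in> lists (e ` {..k - m} \<union> x ` {..k}). x k \<in> set u \<and> length u \<le> 2 ^ (k - m)}"
    for m k :: nat
  define U where "U m = {y \<in> M. \<exists>k\<ge>m. \<exists>u\<in>V m k. d (list_product f u) y < (1 / 2) ^ m}" for m
  have V_lists: "u \<in> lists X" "u \<noteq> []" "list_product f u \<in> M" if "u \<in> V m k" for u m k
  proof -
    have "e ` {..k - m} \<union> x ` {..k} \<subseteq> X" using eX x MX by auto
    then show u: "u \<in> lists X" using that lists_mono unfolding V_def by blast
    show "u \<noteq> []" using that by (auto simp: V_def)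
    show "list_product f u \<in> M"
      using list_product_in_ideal[OF M(1) u] that x(1)[of k] by (auto simp: V_def)
  qed
  have V_mono: "V m' k \<subseteq> V m k" if "m \<le> m'" for m m' k
  proof -
    have "k - m' \<le> k - m" using that by simp
    then have "e ` {..k - m'} \<union> x ` {..k} \<subseteq> e ` {..k - m} \<union> x ` {..k}"
      and "(2::nat) ^ (k - m') \<le> 2 ^ (k - m)" by auto
    then show ?thesis unfolding V_def using lists_mono by (blast intro: order_trans)
  qed
  have half: "(1 / 2) ^ Suc m + (1 / 2) ^ Suc m = ((1::real) / 2) ^ m" for m by simp
  have U_mono: "U m' \<subseteq> U m" if "m \<le> m'" for m m'
  proof -
    have "((1::real) / 2) ^ m' \<le> (1 / 2) ^ m" using that by (intro power_decreasing) auto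
    then have less: "t < (1 / 2) ^ m" if "t < (1 / 2) ^ m'" for t :: real using that by linarith
    show ?thesis
      unfolding U_def using less order_trans[OF that] V_mono[OF that] by blast
  qed
  have "\<Inter> (range U) \<noteq> {}"
  proof (rule zero_neighbourhoods_have_common_point)
    show "Y \<subseteq> X" if "Y \<in> range U" for Y using that MX by (auto simp: U_def)
    show "Y \<noteq> {}" if Y: "Y \<in> range U" for Y
    proof -
      obtain m where m: "Y = U m" using Y by blast
      have "[x m] \<in> V m m" by (simp add: V_def)
      moreover have "d (list_product f [x m]) (x m) < (1 / 2) ^ m" using x(1)[of m] MX by auto
      ultimately have "x m \<in> U m" using x(1)[of m] unfolding U_def by blast
      then show ?thesis using m by blast
    qed
    show "\<exists>Z\<in>range U. Z \<subseteq> Y \<inter> Y'" if Y: "Y \<in> range U" "Y' \<in> range U" for Y Y'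
    proof -
      obtain m m' where "Y = U m" "Y' = U m'" using Y by blast
      then show ?thesis using U_mono[of m "max m m'"] U_mono[of m' "max m m'"] by auto
    qed
    show "\<exists>Z\<in>range U. \<forall>y\<in>Z. \<forall>z\<in>Z. f y z \<in> Y" if Y: "Y \<in> range U" for Y
    proof -
      obtain m where m: "Y = U m" using Y by blast
      have "f y z \<in> U m" if yz: "y \<in> U (Suc m)" "z \<in> U (Suc m)" for y z
      proof -
        obtain k u where u: "k \<ge> Suc m" "u \<in> V (Suc m) k" "d (list_product f u) y < (1 / 2) ^ Suc m"
          using yz(1) unfolding U_def by blast
        obtain l v where v: "l \<ge> Suc m" "v \<in> V (Suc m) l" "d (list_product f v) z < (1 / 2) ^ Suc m"
          using yz(2) unfolding U_def by blast
        have yzM: "y \<in> M" "z \<in> M" using yz by (auto simp: U_def)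
        have "u @ v \<in> V m (max k l)"
        proof -
          have le: "k - Suc m \<le> max k l - m" "l - Suc m \<le> max k l - m" "k \<le> max k l" "l \<le> max k l"
            by auto
          have sub: "{..k - Suc m} \<subseteq> {..max k l - m}" "{..l - Suc m} \<subseteq> {..max k l - m}"
            "{..k} \<subseteq> {..max k l}" "{..l} \<subseteq> {..max k l}" using le by (simp_all only: atMost_subset_iff)
          have "length u \<le> 2 ^ (k - Suc m)" "length v \<le> 2 ^ (l - Suc m)"
            using u v by (auto simp: V_def)
          moreover have "(2::nat) ^ (k - Suc m) \<le> 2 ^ (max k l - Suc m)"
            "(2::nat) ^ (l - Suc m) \<le> 2 ^ (max k l - Suc m)" by (intro power_increasing; simp)+
          moreover have "(2::nat) ^ (max k l - m) = 2 * 2 ^ (max k l - Suc m)"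
          proof -
            \<comment> \<open>As k > m, lowering m by one doubles the length bound, as the
              concatenation of two words requires.\<close>
            have "max k l - m = Suc (max k l - Suc m)" using u(1) by auto
            then show ?thesis by simp
          qed
          ultimately have "length (u @ v) \<le> 2 ^ (max k l - m)"
            unfolding length_append by linarith
          moreover have "u @ v \<in> lists (e ` {..max k l - m} \<union> x ` {..max k l})"
          proof -
            have "e ` {..k - Suc m} \<union> x ` {..k} \<subseteq> e ` {..max k l - m} \<union> x ` {..max k l}"
              "e ` {..l - Suc m} \<union> x ` {..l} \<subseteq> e ` {..max k l - m} \<union> x ` {..max k l}"
              by (intro Un_mono image_mono sub)+
            from this[THEN lists_mono] show ?thesis
              using u(2) v(2) unfolding V_def append_in_lists_conv by blast
          qed
          moreover have "x (max k l) \<in> set (u @ v)"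
            using u(2) v(2) by (auto simp: V_def max_def)
          ultimately show ?thesis by (simp add: V_def)
        qed
        moreover have "d (list_product f (u @ v)) (f y z) < (1 / 2) ^ m"
        proof -
          have "list_product f (u @ v) = f (list_product f u) (list_product f v)"
            by (rule list_product_append[OF V_lists(2)[OF u(2)] V_lists(2)[OF v(2)]
                  V_lists(1)[OF u(2)] V_lists(1)[OF v(2)]])
          moreover have "d (f (list_product f u) (list_product f v)) (f y z)
            \<le> d (list_product f u) y + d (list_product f v) z"
            using dist_mult V_lists(3)[OF u(2)] V_lists(3)[OF v(2)] yzM MX by blast
          ultimately show ?thesis using u(3) v(3) half by (smt (verit))
        qed
        moreover have "f y z \<in> M" using yzM M(1) MX by (auto simp: two_sided_ideal_def)
        moreover have "max k l \<ge> m" using u(1) by simp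
        ultimately show ?thesis unfolding U_def by blast
      qed
      then show ?thesis unfolding m by blast
    qed
    show "\<exists>Z\<in>range U. \<forall>y\<in>Z. f a y \<in> Y \<and> f y a \<in> Y" if Y: "Y \<in> range U" and a: "a \<in> X" for Y a
    proof -
      obtain m where m: "Y = U m" using Y by blast
      obtain j where j: "d (e j) a < (1 / 2) ^ Suc m" using dense[OF a, of "(1 / 2) ^ Suc m"] by auto
      define m' where "m' = m + Suc j"
      have "f a y \<in> U m \<and> f y a \<in> U m" if y: "y \<in> U m'" for y
      proof -
        obtain k u where u: "k \<ge> m'" "u \<in> V m' k" "d (list_product f u) y < (1 / 2) ^ m'"
          using y unfolding U_def by blast
        have "((1::real) / 2) ^ m' \<le> (1 / 2) ^ Suc m"
          by (intro power_decreasing) (auto simp: m'_def)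
        then have du: "d (list_product f u) y < (1 / 2) ^ Suc m" using u(3) by linarith
        have yM: "y \<in> M" using y by (simp add: U_def)
        have len: "Suc (length u) \<le> 2 ^ (k - m)"
        proof -
          have "length u \<le> 2 ^ (k - m')" using u(2) by (simp add: V_def)
          also have "(2::nat) ^ (k - m') < 2 ^ (k - m)"
            using u(1) by (intro power_strict_increasing) (auto simp: m'_def)
          finally show ?thesis by simp
        qed
        have "u \<in> V m k" using u(2) V_mono[of m m' k] by (auto simp: m'_def)
        then have V: "e j # u \<in> V m k" "u @ [e j] \<in> V m k"
          using len u(1) by (auto simp: V_def m'_def)
        have "list_product f (e j # u) = f (e j) (list_product f u)"
          "list_product f (u @ [e j]) = f (list_product f u) (e j)"
          using V_lists[OF u(2)] eX by (auto simp: list_product_Cons list_product_append)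
        then have "d (list_product f (e j # u)) (f a y) < (1 / 2) ^ m"
          "d (list_product f (u @ [e j])) (f y a) < (1 / 2) ^ m"
        proof -
          have "list_product f u \<in> X" "y \<in> X" using V_lists(3)[OF u(2)] yM MX by blast+
          then have "d (f (e j) (list_product f u)) (f a y) \<le> d (e j) a + d (list_product f u) y"
            "d (f (list_product f u) (e j)) (f y a) \<le> d (list_product f u) y + d (e j) a"
            using dist_mult eX a by blast+
          moreover assume "list_product f (e j # u) = f (e j) (list_product f u)"
            "list_product f (u @ [e j]) = f (list_product f u) (e j)"
          ultimately show "d (list_product f (e j # u)) (f a y) < (1 / 2) ^ m"
            "d (list_product f (u @ [e j])) (f y a) < (1 / 2) ^ m"
            using j du half by (smt (verit))+
        qed
        moreover have "f a y \<in> M" "f y a \<in> M" using yM a M(1) by (auto simp: two_sided_ideal_def)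
        moreover have "k \<ge> m" using u(1) by (simp add: m'_def)
        ultimately show ?thesis using V unfolding U_def by blast
      qed
      then show ?thesis unfolding m by blast
    qed
  qed auto
  then obtain b where b: "\<And>m. b \<in> U m" by auto
  then have "b \<in> M" by (auto simp: U_def)
  then obtain i where i: "good i" "b \<in> B i" using good_cover by blast
  \<comment> \<open>The slack of b inside the ball of \<open>B i\<close>: points of M closer than
    \<eta> to b are in \<open>B i\<close> too.\<close>
  define \<eta> where "\<eta> = 1 / Suc (snd (prod_decode i)) - d (e (fst (prod_decode i))) b"
  have "\<eta> > 0" using i(2) by (simp add: \<eta>_def B_def)
  then obtain n where n: "(1 / 2) ^ n < \<eta>" using real_arch_pow_inv[of \<eta> "1 / 2"] by auto
  \<comment> \<open>m >= i ensures i <= k below, so that \<open>B i\<close> was among the sets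
    avoided at stage k.\<close>
  define m where "m = max i n"
  have "((1::real) / 2) ^ m \<le> (1 / 2) ^ n" by (intro power_decreasing) (auto simp: m_def)
  then have m: "(1 / 2) ^ m < \<eta>" using n by linarith
  obtain k u where u: "k \<ge> m" "u \<in> V m k" "d (list_product f u) b < (1 / 2) ^ m"
    using b[of m] unfolding U_def by blast
  have "list_product f u \<in> B i"
  proof -
    have p: "list_product f u \<in> M" by (rule V_lists(3)[OF u(2)])
    then have "d (e (fst (prod_decode i))) (list_product f u)
      \<le> d (e (fst (prod_decode i))) b + d b (list_product f u)"
      using triangle eX \<open>b \<in> M\<close> MX by blast
    then show ?thesis
      using p m u(3) commute[of "list_product f u" b] unfolding B_def \<eta>_def by simp
  qed
  moreover have "abstract_letter (x k) u \<in> W x k"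
  proof -
    have "{..k} = insert k {..<k}" by auto
    then have "x ` {..k} = insert (x k) (x ` {..<k})" by simp
    moreover have "e ` {..k - m} \<subseteq> e ` {..k}" by (intro image_mono) simp
    ultimately have "e ` {..k - m} \<union> x ` {..k} \<subseteq> insert (x k) (S x k)"
      unfolding S_def by blast
    from lists_mono[OF this] have "u \<in> lists (insert (x k) (S x k))"
      using u(2) unfolding V_def by blast
    moreover have "length u \<le> 2 ^ (k - m)" using u(2) by (simp add: V_def)
    then have "length u \<le> 2 ^ k" by (rule order_trans) simp
    moreover have "x k \<in> set u" using u(2) by (simp add: V_def)
    ultimately show ?thesis
      unfolding W_def by (simp only: mem_Collect_eq length_abstract_letter abstract_letter_in_patterns)
  qed
  moreover have "i \<le> k" using u(1) by (simp add: m_def)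
  ultimately show False using x(2) i(1) pattern_value_abstract_letter by metis
qed

text \<open>Constant letters contribute 0 and each variable d x y. This makes algebraic sets
  closed.\<close>

lemma pattern_value_lipschitz:
  assumes "w \<in> patterns X" "x \<in> X" "y \<in> X"
  shows "d (pattern_value f w x) (pattern_value f w y) \<le> length w * d x y"
proof -
  have "list_all2 (\<lambda>a b. a \<in> X \<and> b \<in> X \<and> d a b \<le> d x y)
    (map (case_option x id) w) (map (case_option y id) w)"
    using assms patternsD(1)[OF assms(1)]
    by (auto simp: list.rel_map intro!: list.rel_refl_strong split: option.split)
  from dist_list_product[OF this] show ?thesis
    using patternsD(3)[OF assms(1)] by (simp add: pattern_value_def)
qed

lemma separable_imp_finitely_covered:
  assumes cov: "cov_meager =o |UNIV :: real set|"
    and e: "range e \<subseteq> X" and dense: "\<And>x \<delta>. x \<in> X \<Longrightarrow> \<delta> > 0 \<Longrightarrow> \<exists>i::nat. d (e i) x < \<delta>"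
  shows "finitely_covered X"
proof -
  have eX: "e i \<in> X" for i using e by auto
  then have "X \<noteq> {}" by blast
  then obtain M where M: "M \<noteq> {}" "two_sided_ideal M" "closedin mtopology M"
    and minimal: "\<And>N. N \<noteq> {} \<Longrightarrow> two_sided_ideal N \<Longrightarrow> closedin mtopology N \<Longrightarrow> N \<subseteq> M \<Longrightarrow> N = M"
    by (rule minimal_closed_ideal) blast
  have MX: "M \<subseteq> X" using M by (simp add: two_sided_ideal_def)
  have approx: "\<exists>n i. 1 / Suc n < \<delta> \<and> d (e i) x < 1 / Suc n" if "x \<in> X" "\<delta> > 0" for x \<delta>
  proof -
    obtain n where n: "1 / Suc n < \<delta>" using nat_approx_posE[OF \<open>\<delta> > 0\<close>] by blast
    moreover obtain i where "d (e i) x < 1 / Suc n" using dense[OF \<open>x \<in> X\<close>, of "1 / Suc n"] by auto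
    ultimately show ?thesis by blast
  qed
  \<comment> \<open>The balls of a countable family that contain x determine x, so X has at most
    continuum many points.\<close>
  have "inj_on (\<lambda>x. {p. d (e (fst (prod_decode p))) x < 1 / Suc (snd (prod_decode p))}) X"
  proof (rule inj_onI, rule ccontr)
    fix x y assume xy: "x \<in> X" "y \<in> X" "x \<noteq> y"
      and eq: "{p. d (e (fst (prod_decode p))) x < 1 / Suc (snd (prod_decode p))} =
        {p. d (e (fst (prod_decode p))) y < 1 / Suc (snd (prod_decode p))}"
    then have "d x y / 2 > 0" by (simp add: mdist_pos_less)
    then obtain n i where ni: "1 / Suc n < d x y / 2" "d (e i) x < 1 / Suc n"
      using approx xy(1) by blast
    then have "prod_encode (i, n) \<in> {p. d (e (fst (prod_decode p))) x < 1 / Suc (snd (prod_decode p))}"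
      by simp
    then have "d (e i) y < 1 / Suc n" unfolding eq by simp
    then show False using triangle[of x "e i" y] ni eX xy commute[of x "e i"] by simp
  qed
  then have "|X| \<le>o |UNIV :: nat set set|" using card_of_ordLeq by blast
  moreover have "|UNIV :: nat set set| =o |UNIV :: real set|"
    using nat_sets_eqpoll_reals by (simp add: eqpoll_def card_of_ordIso)
  ultimately have "|X| \<le>o |UNIV :: real set|" by (rule ordLeq_ordIso_trans)
  then obtain \<P> where P: "\<P> \<subseteq> patterns X \<times> X" "|\<P>| <o |UNIV :: real set|"
    "\<And>x. x \<in> X \<Longrightarrow> \<exists>(w, b)\<in>\<P>. pattern_value f w x = b"
    using covered_by_few_algebraic_sets[OF card_of_nat_ordLess_real] by blast
  interpret M: Metric_space M d by (rule subspace[OF MX])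
  define \<A> where "\<A> = (\<lambda>(w, b). {x \<in> M. pattern_value f w x = b}) ` \<P>"
  \<comment> \<open>A dense sequence inside M: a point of M is picked from every ball of the
    countable family that meets M.\<close>
  define e' where "e' p = (SOME y. y \<in> M \<and> ((\<exists>y\<in>M. d (e (fst (prod_decode p))) y < 1 / Suc (snd (prod_decode p)))
    \<longrightarrow> d (e (fst (prod_decode p))) y < 1 / Suc (snd (prod_decode p))))" for p
  have e': "e' p \<in> M \<and> ((\<exists>y\<in>M. d (e (fst (prod_decode p))) y < 1 / Suc (snd (prod_decode p)))
    \<longrightarrow> d (e (fst (prod_decode p))) (e' p) < 1 / Suc (snd (prod_decode p)))" for p
    unfolding e'_def by (rule someI_ex) (use M(1) in blast)
  have "\<exists>A\<in>\<A>. \<exists>q\<in>M. \<exists>\<epsilon>>0. M.mball q \<epsilon> \<subseteq> A"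
  proof (rule M.ball_in_some_closed_set[OF cov _ M(1)])
    show "M.mcomplete" using Submetric.closedin_mcomplete_imp_mcomplete[of X d M] complete M(3) MX
      by (simp add: Submetric_def Submetric_axioms_def Metric_space_axioms)
    show "range e' \<subseteq> M" using e' by auto
    show "\<exists>i. d (e' i) x < \<delta>" if x: "x \<in> M" and "\<delta> > 0" for x \<delta>
    proof -
      obtain n i where ni: "1 / Suc n < \<delta> / 2" "d (e i) x < 1 / Suc n"
        using approx[of x "\<delta> / 2"] x MX \<open>\<delta> > 0\<close> by auto
      then have "d (e i) (e' (prod_encode (i, n))) < 1 / Suc n"
        using e'[of "prod_encode (i, n)"] x by auto
      then have "d (e' (prod_encode (i, n))) x < \<delta>"
      proof -
        have "d (e' (prod_encode (i, n))) x \<le> d (e' (prod_encode (i, n))) (e i) + d (e i) x"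
          using triangle e' MX x eX by blast
        moreover assume "d (e i) (e' (prod_encode (i, n))) < 1 / Suc n"
        ultimately show ?thesis using ni commute[of "e i"] by (smt (verit) field_sum_of_halves)
      qed
      then show ?thesis by blast
    qed
    show "|\<A>| <o |UNIV :: real set|"
      unfolding \<A>_def using ordLeq_ordLess_trans[OF card_of_image P(2)] .
    show "M \<subseteq> \<Union>\<A>" using P(3) MX by (force simp: \<A>_def)
    show "closedin M.mtopology A" if A: "A \<in> \<A>" for A
      unfolding M.closedin_metric
    proof (intro conjI allI impI)
      obtain w b where wb: "w \<in> patterns X" "b \<in> X" "A = {x \<in> M. pattern_value f w x = b}"
        using A P(1) by (auto simp: \<A>_def)
      then show "A \<subseteq> M" by auto
      fix x assume x: "x \<in> M - A"
      let ?v = "pattern_value f w"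
      define \<rho> where "\<rho> = d (?v x) b / length w"
      have len: "length w > 0" using patternsD(3)[OF wb(1)] by simp
      have vX: "?v y \<in> X" if "y \<in> M" for y using pattern_value_closed wb(1) that MX by blast
      have "\<rho> > 0" using x wb vX[of x] len by (auto simp: \<rho>_def mdist_pos_less)
      moreover have "y \<notin> A" if "y \<in> M.mball x \<rho>" for y
      proof
        assume "y \<in> A"
        then have "?v y = b" using wb(3) by simp
        then have "d (?v x) b \<le> length w * d x y"
          using pattern_value_lipschitz[OF wb(1), of x y] x that MX by auto
        moreover have "d x y < \<rho>" using that by simp
        ultimately show False using len by (simp add: \<rho>_def field_simps)
      qed
      ultimately show "\<exists>r>0. disjnt A (M.mball x r)" by (auto simp: disjnt_def)
    qed
  qed
  then obtain q0 \<epsilon>0 w0 c0 where q0: "q0 \<in> M" "\<epsilon>0 > 0" "w0 \<in> patterns X" "c0 \<in> X"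
    "M.mball q0 \<epsilon>0 \<subseteq> {x \<in> M. pattern_value f w0 x = c0}"
    using P(1) by (auto simp: \<A>_def)
  define loc where "loc b \<longleftrightarrow>
    (\<exists>w\<in>patterns X. \<exists>c\<in>X. \<exists>\<epsilon>>0. \<forall>x\<in>M. d b x < \<epsilon> \<longrightarrow> pattern_value f w x = c)" for b
  define Q where "Q = {x \<in> M. \<not> loc x}"
  have ideal_M: "f a x \<in> M" "f x a \<in> M" if "a \<in> X" "x \<in> M" for a x
    using M(2) that by (auto simp: two_sided_ideal_def)
  \<comment> \<open>Constancy of w near h x gives constancy of w composed with v near x. With h a
    translation, the points that are not \<open>loc\<close> form an ideal.\<close>
  have pull: "loc x" if h: "\<And>y. y \<in> X \<Longrightarrow> pattern_value f v y = h y" "v \<in> patterns X"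
    "\<And>y. y \<in> M \<Longrightarrow> h y \<in> M" "\<And>y. y \<in> M \<Longrightarrow> d (h x) (h y) \<le> d x y" and "loc (h x)" for x h v
  proof -
    obtain w c \<epsilon> where w: "w \<in> patterns X" "c \<in> X" "\<epsilon> > 0"
      "\<And>y. y \<in> M \<Longrightarrow> d (h x) y < \<epsilon> \<Longrightarrow> pattern_value f w y = c"
      using \<open>loc (h x)\<close> unfolding loc_def by blast
    have "pattern_value f (pattern_comp w v) y = c" if "y \<in> M" "d x y < \<epsilon>" for y
      using pattern_value_comp[OF w(1) h(2), of y] h(1)[of y] h(3)[OF that(1)] h(4)[OF that(1)] w(4) that MX
      by auto
    then show ?thesis
      unfolding loc_def using w(2,3) pattern_comp_in_patterns[OF w(1) h(2)]
      by (intro bexI[of _ "pattern_comp w v"] bexI[of _ c] exI[of _ \<epsilon>]) auto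
  qed
  have Q_ideal: "two_sided_ideal Q"
    unfolding two_sided_ideal_def
  proof (intro conjI ballI)
    show "Q \<subseteq> X" using MX by (auto simp: Q_def)
    fix a x assume a: "a \<in> X" and x: "x \<in> Q"
    then have xM: "x \<in> M" "\<not> loc x" by (auto simp: Q_def)
    have "loc x" if "loc (f a x)"
    proof (rule pull[of "[Some a, None]" "f a"])
      show "[Some a, None] \<in> patterns X" using a by (auto intro: patternsI)
      show "d (f a x) (f a y) \<le> d x y" if "y \<in> M" for y
        using that xM(1) a MX left_subinvariant by blast
    qed (use that a ideal_M in \<open>auto simp: pattern_value_def\<close>)
    moreover have "loc x" if "loc (f x a)"
    proof (rule pull[of "[None, Some a]" "\<lambda>y. f y a"])
      show "[None, Some a] \<in> patterns X" using a by (auto intro: patternsI)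
      show "d (f x a) (f y a) \<le> d x y" if "y \<in> M" for y
        using that xM(1) a MX right_subinvariant by blast
    qed (use that a ideal_M in \<open>auto simp: pattern_value_def\<close>)
    ultimately have "\<not> loc (f a x)" "\<not> loc (f x a)" using xM(2) by blast+
    then show "f a x \<in> Q" "f x a \<in> Q" using ideal_M a xM by (auto simp: Q_def)
  qed
  have Q_closed: "closedin mtopology Q"
  proof -
    have "openin mtopology (X - Q)"
      unfolding openin_mtopology
    proof (intro conjI allI impI)
      fix x assume x: "x \<in> X - Q"
      show "\<exists>r>0. mball x r \<subseteq> X - Q"
      proof (cases "x \<in> M")
        case False
        then obtain r where "r > 0" "disjnt M (mball x r)"
          using M(3) x by (auto simp: closedin_metric)
        then show ?thesis by (intro exI[of _ r]) (auto simp: disjnt_def Q_def)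
      next
        case True
        then obtain w c \<epsilon> where w: "w \<in> patterns X" "c \<in> X" "\<epsilon> > 0"
          "\<And>y. y \<in> M \<Longrightarrow> d x y < \<epsilon> \<Longrightarrow> pattern_value f w y = c"
          using x unfolding Q_def loc_def by blast
        have "loc z" if z: "z \<in> mball x (\<epsilon> / 2)" "z \<in> M" for z
        proof -
          have "d x y < \<epsilon>" if "y \<in> M" "d z y < \<epsilon> / 2" for y
            using that z triangle[of x z y] MX by auto
          then show ?thesis unfolding loc_def using w by (meson half_gt_zero)
        qed
        then show ?thesis using w(3) by (intro exI[of _ "\<epsilon> / 2"]) (auto simp: Q_def)
      qed
    qed auto
    moreover have "Q \<subseteq> X" using Q_ideal by (simp add: two_sided_ideal_def)
    ultimately show ?thesis by (simp add: closedin_def)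
  qed
  have "pattern_value f w0 x = c0" if "x \<in> M" "d q0 x < \<epsilon>0" for x
    using q0(1,5) that by (auto simp: subset_iff)
  then have "loc q0" unfolding loc_def using q0(2-4) by blast
  then have "q0 \<notin> Q" by (simp add: Q_def)
  moreover have "Q \<subseteq> M" by (auto simp: Q_def)
  \<comment> \<open>A nonempty Q would equal M by minimality, but it misses q0.\<close>
  ultimately have "Q = {}" using minimal[OF _ Q_ideal Q_closed] q0(1) by blast
  then have "loc b" if "b \<in> M" for b using that by (auto simp: Q_def)
  then show ?thesis
    unfolding loc_def by (intro locally_constant_imp_finitely_covered[OF M(2,1) e dense])
qed

end

section \<open>From continuous pseudometrics to power-Lindeloef topologies\<close>

lemma power_Lindelof_imp_Lindelof:
  assumes "power_Lindelof \<tau>"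
  shows "Lindelof_space \<tau>"
proof -
  let ?P = "product_topology (\<lambda>_. \<tau>) {..<1::nat}"
  have "Lindelof_space ?P" using assms by (simp only: power_Lindelof_def)
  moreover have "continuous_map ?P \<tau> (\<lambda>c. c 0)"
    by (rule continuous_map_product_projection) simp
  moreover have "(\<lambda>c. c 0) ` topspace ?P = topspace \<tau>"
    by (auto simp: image_projection_PiE PiE_eq_empty_iff)
  ultimately show ?thesis by (rule Lindelof_space_continuous_map_image)
qed

section \<open>Continuous subinvariant pseudometrics and countable domination\<close>

context carrier_semigroup
begin

text \<open>That balls are neighbourhoods of their centres amounts to joint continuity by the
  triangle inequality, and is easier to check for suprema.\<close>

definition continuous_pseudometric :: "'a topology \<Rightarrow> ('a \<Rightarrow> 'a \<Rightarrow> real) \<Rightarrow> bool" where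
  "continuous_pseudometric \<tau> d \<longleftrightarrow> pseudometric_semigroup X f d \<and>
     (\<forall>u\<in>X. \<forall>\<epsilon>>0. \<exists>V. openin \<tau> V \<and> u \<in> V \<and> (\<forall>v\<in>V. d u v < \<epsilon>))"

lemma continuous_pseudometricI:
  assumes d: "subinvariant_pseudometric X f d" and top: "topspace \<tau> = X"
    and cont: "continuous_map (prod_topology \<tau> \<tau>) euclideanreal (\<lambda>(u, v). d u v)"
  shows "continuous_pseudometric \<tau> d"
  unfolding continuous_pseudometric_def
proof (intro conjI ballI allI impI)
  have pm: "pseudometric_on X d" and sub: "\<And>x y a b. x \<in> X \<Longrightarrow> y \<in> X \<Longrightarrow> a \<in> adjoin_unit X \<Longrightarrow>
      b \<in> adjoin_unit X \<Longrightarrow> d (the (unit_mult f (unit_mult f a (Some x)) b))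
        (the (unit_mult f (unit_mult f a (Some y)) b)) \<le> d x y"
    using d by (auto simp: subinvariant_pseudometric_def)
  show "pseudometric_semigroup X f d"
  proof
    show "d (f a x) (f a y) \<le> d x y" if "a \<in> X" "x \<in> X" "y \<in> X" for a x y
      using sub[of x y "Some a" None] that by (simp add: adjoin_unit_def)
    show "d (f x a) (f y a) \<le> d x y" if "a \<in> X" "x \<in> X" "y \<in> X" for a x y
      using sub[of x y None "Some a"] that by (simp add: adjoin_unit_def)
  qed (use pm in \<open>auto simp: pseudometric_on_def\<close>)
  fix u and \<epsilon> :: real assume u: "u \<in> X" and \<epsilon>: "\<epsilon> > 0"
  have "continuous_map \<tau> (prod_topology \<tau> \<tau>) (\<lambda>v. (u, v))"
    using u top by (simp add: continuous_map_pairwise comp_def)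
  from continuous_map_compose[OF this cont]
  have "continuous_map \<tau> euclideanreal (\<lambda>v. d u v)" by (simp add: comp_def)
  then have "openin \<tau> {v \<in> topspace \<tau>. d u v \<in> {..<\<epsilon>}}"
    by (rule openin_continuous_map_preimage) simp
  then show "\<exists>V. openin \<tau> V \<and> u \<in> V \<and> (\<forall>v\<in>V. d u v < \<epsilon>)"
    using u \<epsilon> top pm by (intro exI[of _ "{v \<in> topspace \<tau>. d u v \<in> {..<\<epsilon>}}"])
      (auto simp: pseudometric_on_def)
qed

lemma continuous_pseudometric_zero:
  "topspace \<tau> = X \<Longrightarrow> continuous_pseudometric \<tau> (\<lambda>_ _. 0)"
  unfolding continuous_pseudometric_def pseudometric_semigroup_def pseudometric_semigroup_axioms_def
  using carrier_semigroup_axioms openin_topspace[of \<tau>] by auto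

text \<open>Take the supremum of the members truncated at 2^-n. Truncation and suprema keep the
  triangle inequality and subinvariance; all but finitely many terms are uniformly small, whence
  continuity.\<close>

lemma continuous_pseudometric_countable_family:
  fixes D :: "'i::countable \<Rightarrow> 'a \<Rightarrow> 'a \<Rightarrow> real"
  assumes D: "\<And>i. continuous_pseudometric \<tau> (D i)" and top: "topspace \<tau> = X"
  obtains d where "continuous_pseudometric \<tau> d"
    "\<And>i u v. u \<in> X \<Longrightarrow> v \<in> X \<Longrightarrow> d u v = 0 \<Longrightarrow> D i u v = 0"
proof -
  define E where "E n u v = min (D (from_nat n) u v) ((1 / 2) ^ n)" for n u v
  define d where "d u v = (SUP n. E n u v)" for u v
  have pm: "pseudometric_semigroup X f (D i)" for i
    using D by (simp add: continuous_pseudometric_def)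
  note D_nonneg = pseudometric_semigroup.dist_nonneg[OF pm]
    and D_sym = pseudometric_semigroup.dist_sym[OF pm]
    and D_triangle = pseudometric_semigroup.dist_triangle[OF pm]
    and D_left = pseudometric_semigroup.dist_left[OF pm]
    and D_right = pseudometric_semigroup.dist_right[OF pm]
  have E_le: "E n u v \<le> 1" for n u v
    by (auto simp: E_def power_le_one intro: min.coboundedI2)
  have bdd: "bdd_above (range (\<lambda>n. E n u v))" for u v using E_le by (auto simp: bdd_above_def)
  have upper: "E n u v \<le> d u v" for n u v
    unfolding d_def by (rule cSUP_upper[OF _ bdd]) simp
  have least: "d u v \<le> t" if "\<And>n. E n u v \<le> t" for u v t
    unfolding d_def using that by (intro cSUP_least) auto
  have E_nonneg: "0 \<le> E n u v" if "u \<in> X" "v \<in> X" for n u v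
    using D_nonneg that by (simp add: E_def)
  have "pseudometric_semigroup X f d"
  proof
    show "0 \<le> d x y" if "x \<in> X" "y \<in> X" for x y
      using E_nonneg[OF that, of 0] upper[of 0 x y] by simp
    show "d x x = 0" if "x \<in> X" for x
      using pseudometric_semigroup.dist_refl[OF pm that] by (simp add: d_def E_def)
    show "d x y = d y x" if "x \<in> X" "y \<in> X" for x y
      using D_sym that by (simp add: d_def E_def)
    show "d x z \<le> d x y + d y z" if "x \<in> X" "y \<in> X" "z \<in> X" for x y z
    proof (rule least)
      fix n
      have "E n x z \<le> E n x y + E n y z"
        using D_triangle[OF that] D_nonneg[OF that(1,2)] D_nonneg[OF that(2,3)]
        unfolding E_def by (smt (verit) zero_less_power zero_less_divide_1_iff)
      then show "E n x z \<le> d x y + d y z" using upper[of n x y] upper[of n y z] by linarith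
    qed
    show "d (f a x) (f a y) \<le> d x y" if "a \<in> X" "x \<in> X" "y \<in> X" for a x y
    proof (rule least)
      fix n
      have "E n (f a x) (f a y) \<le> E n x y" unfolding E_def using D_left[OF that] by (rule min.mono) simp
      then show "E n (f a x) (f a y) \<le> d x y" using upper[of n x y] by linarith
    qed
    show "d (f x a) (f y a) \<le> d x y" if "a \<in> X" "x \<in> X" "y \<in> X" for a x y
    proof (rule least)
      fix n
      have "E n (f x a) (f y a) \<le> E n x y" unfolding E_def using D_right[OF that] by (rule min.mono) simp
      then show "E n (f x a) (f y a) \<le> d x y" using upper[of n x y] by linarith
    qed
  qed
  moreover have "\<exists>V. openin \<tau> V \<and> u \<in> V \<and> (\<forall>v\<in>V. d u v < \<epsilon>)" if u: "u \<in> X" and \<epsilon>: "\<epsilon> > 0" for u \<epsilon>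
  proof -
    obtain N where N: "(1 / 2) ^ N < \<epsilon> / 2" using real_arch_pow_inv[of "\<epsilon> / 2" "1 / 2"] \<epsilon> by auto
    have "\<exists>V. openin \<tau> V \<and> u \<in> V \<and> (\<forall>v\<in>V. D i u v < \<epsilon> / 2)" for i
      using D[of i] u half_gt_zero[OF \<epsilon>] unfolding continuous_pseudometric_def by blast
    then obtain W where W: "\<And>i. openin \<tau> (W i)" "\<And>i. u \<in> W i" "\<And>i v. v \<in> W i \<Longrightarrow> D i u v < \<epsilon> / 2"
      by metis
    define V where "V = X \<inter> (\<Inter>n\<in>{..N}. W (from_nat n))"
    have "openin \<tau> (\<Inter>n\<in>{..N}. W (from_nat n))" using W(1) by (intro openin_Inter) auto
    then have "openin \<tau> V" unfolding V_def using top by (metis openin_Int openin_topspace)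
    moreover have "d u v < \<epsilon>" if "v \<in> V" for v
    proof -
      have "d u v \<le> \<epsilon> / 2"
      proof (rule least)
        fix n
        show "E n u v \<le> \<epsilon> / 2"
        proof (cases "n \<le> N")
          case True
          then have "D (from_nat n) u v < \<epsilon> / 2" using that W(3) by (auto simp: V_def)
          then show ?thesis by (simp add: E_def)
        next
          case False
          then have "((1::real) / 2) ^ n \<le> (1 / 2) ^ N" by (intro power_decreasing) auto
          then have "((1::real) / 2) ^ n \<le> \<epsilon> / 2" using N by linarith
          then show ?thesis unfolding E_def by (rule min.coboundedI2)
        qed
      qed
      then show ?thesis using \<epsilon> by simp
    qed
    ultimately show ?thesis using W(2) u by (intro exI[of _ V]) (auto simp: V_def)
  qed
  ultimately have "continuous_pseudometric \<tau> d" by (simp add: continuous_pseudometric_def)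
  moreover have "D i u v = 0" if uv: "u \<in> X" "v \<in> X" "d u v = 0" for i u v
  proof -
    \<comment> \<open>The truncation height is positive, so it cannot be what makes the minimum
      vanish.\<close>
    have "E (to_nat i) u v \<le> 0" using upper[of "to_nat i" u v] uv(3) by simp
    moreover have "((1::real) / 2) ^ to_nat i > 0" by simp
    ultimately have "D i u v \<le> 0" unfolding E_def min_le_iff_disj from_nat_to_nat by linarith
    then show ?thesis using D_nonneg[OF uv(1,2), of i] by simp
  qed
  ultimately show thesis by (rule that)
qed

end

section \<open>Evaluating patterns in the metric quotient\<close>

context pseudometric_semigroup
begin

lemma quotient_carrier_subset: "quotient_carrier \<subseteq> X"
  using representative(1) by (auto simp: quotient_carrier_def)

lemma representative_idem: "c \<in> quotient_carrier \<Longrightarrow> representative c = c"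
  by (auto simp: quotient_carrier_def representative_eq_iff representative)

lemma representative_list_product:
  "us \<noteq> [] \<Longrightarrow> us \<in> lists X \<Longrightarrow>
   representative (list_product f us) = list_product quotient_mult (map representative us)"
  by (induction us rule: induct_list012) (auto simp: representative_mult list_product_closed)

text \<open>Coefficients from the quotient are their own representatives, so one word can be read
  both in X and in the quotient.\<close>

lemma representative_pattern_value:
  assumes w: "w \<in> patterns quotient_carrier" and x: "x \<in> X"
  shows "representative (pattern_value f w x) = pattern_value quotient_mult w (representative x)"
proof -
  have "map representative (map (case_option x id) w) = map (case_option (representative x) id) w"
    using patternsD(1)[OF w] by (auto simp: representative_idem split: option.split)
  moreover have "map (case_option x id) w \<in> lists X"
    using patterns_letters[OF w x quotient_carrier_subset] .
  ultimately show ?thesis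
    using patternsD(3)[OF w] representative_list_product[of "map (case_option x id) w"]
    by (simp add: pattern_value_def del: map_map)
qed

end

text \<open>A template is a pattern with an equation whose letters are replaced by indices into a tuple of
  elements. There are only countably many of them, so one template serves all pseudometrics.\<close>

type_synonym template = "nat \<times> (nat option list \<times> nat) list"

section \<open>Coefficient tuples that solve a template\<close>

definition well_formed :: "template \<Rightarrow> bool" where
  "well_formed t \<longleftrightarrow> (\<forall>(w, j)\<in>set (snd t). w \<in> patterns {..<fst t} \<and> j < fst t)"

text \<open>\<open>PiE\<close> makes the tuples points of a finite power of X. Equations are asked
  only up to distance zero, as the quotient by d sees no more.\<close>

definition solutions ::
  "'a set \<Rightarrow> ('a \<Rightarrow> 'a \<Rightarrow> 'a) \<Rightarrow> ('a \<Rightarrow> 'a \<Rightarrow> real) \<Rightarrow> template \<Rightarrow> (nat \<Rightarrow> 'a) set" where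
  "solutions X f d t = {c \<in> PiE {..<fst t} (\<lambda>_. X).
     \<forall>x\<in>X. \<exists>(w, j)\<in>set (snd t). d (pattern_value f (map (map_option c) w) x) (c j) = 0}"

lemma map_option_patterns:
  assumes "w \<in> patterns I" "c ` I \<subseteq> S"
  shows "map (map_option c) w \<in> patterns S"
proof (rule patternsI)
  show "a \<in> S" if "Some a \<in> set (map (map_option c) w)" for a
    using that assms(2) patternsD(1)[OF assms(1)] by (auto simp: map_option_case split: option.splits)
  show "None \<in> set (map (map_option c) w)"
    using patternsD(2)[OF assms(1)] by (force simp: image_iff)
qed

context carrier_semigroup
begin

lemma solutions_mono:
  assumes "well_formed t" "\<And>u v. u \<in> X \<Longrightarrow> v \<in> X \<Longrightarrow> d u v = 0 \<Longrightarrow> d' u v = 0"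
  shows "solutions X f d t \<subseteq> solutions X f d' t"
proof
  fix c assume c: "c \<in> solutions X f d t"
  then have cX: "c ` {..<fst t} \<subseteq> X" by (auto simp: solutions_def)
  have "\<exists>(w, j)\<in>set (snd t). d' (pattern_value f (map (map_option c) w) x) (c j) = 0" if x: "x \<in> X" for x
  proof -
    obtain w j where wj: "(w, j) \<in> set (snd t)" "d (pattern_value f (map (map_option c) w) x) (c j) = 0"
      using c x unfolding solutions_def by blast
    then have "w \<in> patterns {..<fst t}" "j < fst t" using assms(1) by (auto simp: well_formed_def)
    then have "pattern_value f (map (map_option c) w) x \<in> X" "c j \<in> X"
      using cX map_option_patterns[OF _ cX] x pattern_value_closed by auto
    then show ?thesis using wj assms(2) by blast
  qed
  then show "c \<in> solutions X f d' t" using c by (simp add: solutions_def)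
qed

text \<open>If all equations fail at x for the tuple c, the finitely many of them fail by a common
  positive margin. Values are Lipschitz in the coefficients, so the same x refutes all nearby
  tuples.\<close>

lemma closedin_solutions:
  assumes d: "continuous_pseudometric \<tau> d" and top: "topspace \<tau> = X" and t: "well_formed t"
  shows "closedin (product_topology (\<lambda>_. \<tau>) {..<fst t}) (solutions X f d t)"
proof -
  interpret pseudometric_semigroup X f d using d by (simp add: continuous_pseudometric_def)
  let ?P = "product_topology (\<lambda>_. \<tau>) {..<fst t}"
  have topP: "topspace ?P = PiE {..<fst t} (\<lambda>_. X)" by (simp add: top)
  have "\<exists>V. openin ?P V \<and> c \<in> V \<and> V \<subseteq> topspace ?P - solutions X f d t"
    if c: "c \<in> topspace ?P - solutions X f d t" for c
  proof -
    have cP: "c \<in> PiE {..<fst t} (\<lambda>_. X)" using c unfolding topP by blast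
    then have cX: "c ` {..<fst t} \<subseteq> X" by (auto simp: PiE_iff)
    let ?v = "\<lambda>c w x. pattern_value f (map (map_option c) w) x"
    have vX: "?v c w x \<in> X" if "w \<in> patterns {..<fst t}" "c ` {..<fst t} \<subseteq> X" "x \<in> X" for c w x
      using map_option_patterns[OF that(1,2)] that(3) pattern_value_closed by blast
    obtain x where x: "x \<in> X" "\<And>w j. (w, j) \<in> set (snd t) \<Longrightarrow> d (?v c w x) (c j) \<noteq> 0"
    proof -
      have "\<not> (\<forall>x\<in>X. \<exists>(w, j)\<in>set (snd t). d (?v c w x) (c j) = 0)"
        using c cP unfolding solutions_def by blast
      then show ?thesis using that by fastforce
    qed
    have wf: "w \<in> patterns {..<fst t}" "j < fst t" if "(w, j) \<in> set (snd t)" for w j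
      using t that by (auto simp: well_formed_def)
    have pos: "d (?v c w x) (c j) > 0" if "(w, j) \<in> set (snd t)" for w j
      using x(2)[OF that] dist_nonneg[OF vX[OF wf(1)[OF that] cX x(1)], of "c j"] cX wf(2)[OF that]
      by force
    define \<epsilon> where "\<epsilon> = Min (insert 1 ((\<lambda>(w, j). d (?v c w x) (c j)) ` set (snd t)))"
    have \<epsilon>: "\<epsilon> > 0" unfolding \<epsilon>_def using pos by (subst Min_gr_iff) auto
    have \<epsilon>_le: "\<epsilon> \<le> d (?v c w x) (c j)" if "(w, j) \<in> set (snd t)" for w j
      unfolding \<epsilon>_def using that by (intro Min_le) force+
    define L where "L = Max (insert 0 ((\<lambda>(w, j). length w) ` set (snd t)))"
    have L: "length w \<le> L" if "(w, j) \<in> set (snd t)" for w j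
      unfolding L_def using that by (intro Max_ge) force+
    \<comment> \<open>At most L summands \<delta> pay for the letters of the word and one for the
      right-hand side; the last one makes the final inequality strict.\<close>
    define \<delta> where "\<delta> = \<epsilon> / (L + 2)"
    have \<delta>: "\<delta> > 0" using \<epsilon> by (simp add: \<delta>_def)
    have "\<exists>V. i < fst t \<longrightarrow> openin \<tau> V \<and> c i \<in> V \<and> (\<forall>v\<in>V. d (c i) v < \<delta>)" for i
    proof (cases "i < fst t")
      case True
      then have "c i \<in> X" using cX by auto
      then show ?thesis using d \<delta> unfolding continuous_pseudometric_def by blast
    qed simp
    then obtain W where W: "\<And>i. i < fst t \<Longrightarrow> openin \<tau> (W i) \<and> c i \<in> W i \<and> (\<forall>v\<in>W i. d (c i) v < \<delta>)"
      by metis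
    have "openin ?P (PiE {..<fst t} W)" using W by (intro iffD2[OF openin_PiE]) auto
    moreover have "c \<in> PiE {..<fst t} W" using W cP by (auto simp: PiE_iff)
    moreover have "c' \<in> topspace ?P - solutions X f d t" if c': "c' \<in> PiE {..<fst t} W" for c'
    proof -
      have W_X: "W i \<subseteq> X" if "i < fst t" for i
        using W[OF that] openin_subset[of \<tau> "W i"] top by blast
      then have c'X: "c' ` {..<fst t} \<subseteq> X" "c' \<in> PiE {..<fst t} (\<lambda>_. X)" using c' by (auto simp: PiE_iff)
      have "d (?v c' w x) (c' j) \<noteq> 0" if wj: "(w, j) \<in> set (snd t)" for w j
      proof
        assume zero: "d (?v c' w x) (c' j) = 0"
        have close: "d (c i) (c' i) \<le> \<delta>" if "i < fst t" for i
          using W[OF that] c' that by (force simp: PiE_iff)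
        have "list_all2 (\<lambda>a b. a \<in> X \<and> b \<in> X \<and> d a b \<le> \<delta>)
          (map (case_option x id) (map (map_option c) w)) (map (case_option x id) (map (map_option c') w))"
          using patternsD(1)[OF wf(1)[OF wj]] close cX c'X x(1) \<delta>
          by (auto simp: list.rel_map intro!: list.rel_refl_strong split: option.split)
        from dist_list_product[OF this] have "d (?v c w x) (?v c' w x) \<le> length w * \<delta>"
          using patternsD(3)[OF wf(1)[OF wj]] by (simp add: pattern_value_def)
        also have "\<dots> \<le> L * \<delta>" using L[OF wj] \<delta> by (intro mult_right_mono) auto
        finally have "d (?v c w x) (?v c' w x) \<le> L * \<delta>" .
        moreover have "c j \<in> X" "c' j \<in> X" using cX c'X wf(2)[OF wj] by auto
        moreover have "?v c w x \<in> X" "?v c' w x \<in> X" using vX wf(1)[OF wj] cX c'X(1) x(1) by auto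
        ultimately have "d (?v c w x) (c j) \<le> L * \<delta> + \<delta>"
          using dist_triangle[of "?v c w x" "?v c' w x" "c j"] dist_triangle[of "?v c' w x" "c' j" "c j"]
            zero close[OF wf(2)[OF wj]] dist_sym[of "c j" "c' j"] by linarith
        also have "\<dots> < (L + 2) * \<delta>" using \<delta> by (simp add: algebra_simps)
        also have "\<dots> = \<epsilon>" by (simp add: \<delta>_def)
        finally show False using \<epsilon>_le[OF wj] by simp
      qed
      then show ?thesis using c'X x(1) unfolding topP solutions_def by blast
    qed
    ultimately show ?thesis by blast
  qed
  then have "openin ?P (topspace ?P - solutions X f d t)" by (subst openin_subopen) blast
  moreover have "solutions X f d t \<subseteq> topspace ?P" unfolding topP solutions_def by blast
  ultimately show ?thesis by (simp add: closedin_def)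
qed

end

section \<open>From covers modulo pseudometrics to a cover of X\<close>

context absolutely_closed_semigroup
begin

text \<open>The metric quotient by d is absolutely closed as an image of X, and separable since
  \<tau> is Lindelof. Its equations hold in X up to distance zero.\<close>

lemma finitely_covered_modulo_pseudometric:
  assumes cov: "cov_meager =o |UNIV :: real set|" and X: "X \<noteq> {}"
    and \<tau>: "topspace \<tau> = X" "Lindelof_space \<tau>" and d: "continuous_pseudometric \<tau> d"
  shows "\<exists>\<P>. finite \<P> \<and> \<P> \<subseteq> patterns X \<times> X \<and> (\<forall>x\<in>X. \<exists>(w, b)\<in>\<P>. d (pattern_value f w x) b = 0)"
proof -
  interpret pseudometric_semigroup X f d using d by (simp add: continuous_pseudometric_def)
  interpret Y: metric_semigroup quotient_carrier quotient_mult quotient_dist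
    by (rule quotient_metric_semigroup)
  have "semigroup_hom X f quotient_carrier quotient_mult representative"
    by (auto simp: semigroup_hom_def quotient_carrier_def representative_mult)
  then have "absolutely_closed_semigroup quotient_carrier quotient_mult \<C>"
    using absolutely_closed_semigroup_image[OF absolutely_closed_semigroup_axioms Y.semigroup]
    by (simp add: quotient_carrier_def)
  then interpret Y: absolutely_closed_metric_semigroup quotient_carrier quotient_mult \<C> quotient_dist
    using Y.metric_semigroup_axioms by (simp add: absolutely_closed_metric_semigroup_def)
  have net: "\<exists>C. countable C \<and> C \<subseteq> X \<and> (\<forall>v\<in>X. \<exists>u\<in>C. d u v < \<epsilon>)" if \<epsilon>: "\<epsilon> > 0" for \<epsilon>
  proof -
    define \<U> where "\<U> = {V. openin \<tau> V \<and> (\<exists>u\<in>X. \<forall>v\<in>V. d u v < \<epsilon>)}"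
    have "x \<in> \<Union>\<U>" if "x \<in> X" for x
      using d \<epsilon> that unfolding continuous_pseudometric_def \<U>_def by blast
    moreover have "V \<subseteq> X" if "V \<in> \<U>" for V
      using that openin_subset[of \<tau> V] \<tau>(1) by (auto simp: \<U>_def)
    ultimately have "\<Union>\<U> = topspace \<tau>" using \<tau>(1) by blast
    moreover have "\<And>V. V \<in> \<U> \<Longrightarrow> openin \<tau> V" by (simp add: \<U>_def)
    ultimately obtain \<V> where V: "countable \<V>" "\<V> \<subseteq> \<U>" "\<Union>\<V> = topspace \<tau>"
      using \<tau>(2) unfolding Lindelof_space_def by metis
    have "\<forall>V\<in>\<V>. \<exists>u. u \<in> X \<and> (\<forall>v\<in>V. d u v < \<epsilon>)" using V(2) by (auto simp: \<U>_def)
    then obtain g where g: "\<And>V. V \<in> \<V> \<Longrightarrow> g V \<in> X \<and> (\<forall>v\<in>V. d (g V) v < \<epsilon>)" by metis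
    have "\<exists>u\<in>g ` \<V>. d u v < \<epsilon>" if "v \<in> X" for v
    proof -
      have "v \<in> \<Union>\<V>" using that V(3) \<tau>(1) by simp
      then show ?thesis using g by blast
    qed
    then show ?thesis using g V(1) by (intro exI[of _ "g ` \<V>"]) auto
  qed
  have "\<exists>C. countable C \<and> C \<subseteq> X \<and> (\<forall>v\<in>X. \<exists>u\<in>C. d u v < 1 / Suc n)" for n :: nat
    by (rule net) simp
  then obtain C where C: "\<And>n. countable (C n)" "\<And>n. C n \<subseteq> X"
    "\<And>n v. v \<in> X \<Longrightarrow> \<exists>u\<in>C n. d u v < 1 / Suc n" by metis
  define e where "e n = representative (from_nat_into (\<Union>n. C n) n)" for n
  obtain x0 where "x0 \<in> X" using X by blast
  then have "(\<Union>n. C n) \<noteq> {}" using C(3)[of x0 0] by blast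
  then have range: "range (from_nat_into (\<Union>n. C n)) = (\<Union>n. C n)"
    using C(1) by (intro range_from_nat_into) auto
  have "Y.finitely_covered quotient_carrier"
  proof (rule Y.separable_imp_finitely_covered[OF cov])
    have "from_nat_into (\<Union>n. C n) n \<in> X" for n using range C(2) by blast
    then show "range e \<subseteq> quotient_carrier" by (auto simp: e_def quotient_carrier_def)
    show "\<exists>i. quotient_dist (e i) y < \<delta>" if y: "y \<in> quotient_carrier" and \<delta>: "\<delta> > 0" for y \<delta>
    proof -
      obtain n where n: "1 / Suc n < \<delta>" using nat_approx_posE[OF \<delta>] by blast
      obtain v where v: "v \<in> X" "y = representative v" using y by (auto simp: quotient_carrier_def)
      obtain u where u: "u \<in> C n" "d u v < 1 / Suc n" using C(3)[OF v(1)] by blast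
      then obtain i where i: "u = from_nat_into (\<Union>n. C n) i" using range by blast
      have "u \<in> X" using u(1) C(2) by blast
      then have "quotient_dist (e i) y = d u v"
        using v quotient_dist_representative[of u v] by (simp add: e_def i)
      then show ?thesis using u(2) n by (intro exI[of _ i]) simp
    qed
  qed
  then obtain \<P> where P: "finite \<P>" "\<P> \<subseteq> patterns quotient_carrier \<times> quotient_carrier"
    "\<And>y. y \<in> quotient_carrier \<Longrightarrow> \<exists>(w, b)\<in>\<P>. pattern_value quotient_mult w y = b"
    unfolding Y.finitely_covered_def by blast
  have "\<P> \<subseteq> patterns X \<times> X"
    using P(2) quotient_carrier_subset patterns_mono[OF quotient_carrier_subset] by blast
  moreover have "\<exists>(w, b)\<in>\<P>. d (pattern_value f w x) b = 0" if x: "x \<in> X" for x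
  proof -
    have "representative x \<in> quotient_carrier" using x by (simp add: quotient_carrier_def)
    then obtain w b where wb: "(w, b) \<in> \<P>" "pattern_value quotient_mult w (representative x) = b"
      using P(3) by blast
    then have "w \<in> patterns quotient_carrier" "w \<in> patterns X"
      using P(2) \<open>\<P> \<subseteq> patterns X \<times> X\<close> by auto
    then have "d (pattern_value f w x) b = 0"
      using representative(2) pattern_value_closed x wb(2) representative_pattern_value by metis
    then show ?thesis using wb(1) by blast
  qed
  ultimately show ?thesis using P(1) by blast
qed

text \<open>The coefficients and right-hand sides of a finite cover are listed as a tuple; replacing
  them by their positions gives the template.\<close>

lemma solutions_nonempty:
  assumes cov: "cov_meager =o |UNIV :: real set|" and X: "X \<noteq> {}"
    and \<tau>: "topspace \<tau> = X" "Lindelof_space \<tau>" and d: "continuous_pseudometric \<tau> d"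
  shows "\<exists>t. well_formed t \<and> solutions X f d t \<noteq> {}"
proof -
  obtain \<P> where P: "finite \<P>" "\<P> \<subseteq> patterns X \<times> X"
    "\<And>x. x \<in> X \<Longrightarrow> \<exists>(w, b)\<in>\<P>. d (pattern_value f w x) b = 0"
    using finitely_covered_modulo_pseudometric[OF assms] by blast
  obtain ps where ps: "set ps = \<P>" using finite_list[OF P(1)] by blast
  let ?L = "(\<Union>(w, b)\<in>\<P>. insert b (Some -` set w))"
  have "finite ?L" using P(1) by (auto intro!: finite_vimageI)
  then obtain cs where cs: "set cs = ?L" using finite_list by blast
  define N where "N = length cs"
  define c where "c = restrict (\<lambda>i. cs ! i) {..<N}"
  define idx where "idx a = (SOME i. i < N \<and> cs ! i = a)" for a
  have idx: "idx a < N" "c (idx a) = a" if "a \<in> ?L" for a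
  proof -
    have "\<exists>i. i < N \<and> cs ! i = a" using that unfolding cs[symmetric] N_def by (simp add: in_set_conv_nth)
    then have "idx a < N \<and> cs ! idx a = a" unfolding idx_def by (rule someI_ex)
    then show "idx a < N" "c (idx a) = a" by (auto simp: c_def)
  qed
  have LX: "?L \<subseteq> X"
    using P(2) patternsD(1) by fastforce
  define t where "t = (N, map (\<lambda>(w, b). (map (map_option idx) w, idx b)) ps)"
  have letters: "b \<in> ?L" "Some a \<in> set w \<Longrightarrow> a \<in> ?L" if "(w, b) \<in> \<P>" for w b a
    using that by auto
  have "well_formed t"
    unfolding well_formed_def
  proof (intro ballI, clarify)
    fix w' j assume "(w', j) \<in> set (snd t)"
    then obtain w b where wb: "(w, b) \<in> \<P>" "w' = map (map_option idx) w" "j = idx b"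
      using ps by (auto simp: t_def)
    have "w' \<in> patterns {..<N}"
      unfolding wb(2)
    proof (rule patternsI)
      show "None \<in> set (map (map_option idx) w)"
        using wb(1) P(2) patternsD(2) by force
      show "i \<in> {..<N}" if "Some i \<in> set (map (map_option idx) w)" for i
      proof -
        obtain a where "Some a \<in> set w" "i = idx a"
          using \<open>Some i \<in> _\<close> by (auto simp: map_option_case split: option.splits)
        then show ?thesis using idx(1)[OF letters(2)[OF wb(1)]] by simp
      qed
    qed
    then show "w' \<in> patterns {..<fst t} \<and> j < fst t"
      using idx(1) letters(1)[OF wb(1)] wb(3) by (simp add: t_def)
  qed
  moreover have "c \<in> solutions X f d t"
    unfolding solutions_def
  proof (intro CollectI conjI ballI)
    have "cs ! i \<in> X" if "i < N" for i using that LX unfolding cs[symmetric] N_def by auto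
    then show "c \<in> PiE {..<fst t} (\<lambda>_. X)" by (auto simp: c_def t_def)
    fix x assume "x \<in> X"
    then obtain w b where wb: "(w, b) \<in> \<P>" "d (pattern_value f w x) b = 0" using P(3) by blast
    have "map (map_option c) (map (map_option idx) w) = w"
    proof -
      have "map_option c (map_option idx l) = l" if "l \<in> set w" for l
      proof (cases l)
        case (Some a)
        then have "a \<in> ?L" using letters(2)[OF wb(1)] that by blast
        then show ?thesis using idx(2) Some by simp
      qed simp
      then show ?thesis by (simp add: map_idI)
    qed
    then have "d (pattern_value f (map (map_option c) (map (map_option idx) w)) x) (c (idx b)) = 0"
      using wb(2) idx(2)[OF letters(1)[OF wb(1)]] by simp
    moreover have "(map (map_option idx) w, idx b) \<in> set (snd t)"
      using wb(1) ps by (force simp: t_def)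
    ultimately show "\<exists>(w, j)\<in>set (snd t). d (pattern_value f (map (map_option c) w) x) (c j) = 0"
      by blast
  qed
  ultimately show ?thesis by blast
qed

lemma power_Lindelof_imp_finitely_covered:
  assumes cov: "cov_meager =o |UNIV :: real set|" and X: "X \<noteq> {}"
    and \<tau>: "topspace \<tau> = X" "power_Lindelof \<tau>" "subinvariant_topology f \<tau>"
  shows "finitely_covered X"
proof -
  note sol = solutions_nonempty[OF cov X \<tau>(1) power_Lindelof_imp_Lindelof[OF \<tau>(2)]]
  have "\<exists>t. well_formed t \<and> (\<forall>d. continuous_pseudometric \<tau> d \<longrightarrow> solutions X f d t \<noteq> {})"
  proof (rule ccontr)
    assume no: "\<not> ?thesis"
    \<comment> \<open>The zero pseudometric serves as default for ill-formed templates, so that D is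
      defined on the whole countable type.\<close>
    have "\<exists>d. continuous_pseudometric \<tau> d \<and> (well_formed t \<longrightarrow> solutions X f d t = {})" for t
      using no continuous_pseudometric_zero[OF \<tau>(1)] by blast
    then obtain D where D: "\<And>t. continuous_pseudometric \<tau> (D t)"
      "\<And>t. well_formed t \<Longrightarrow> solutions X f (D t) t = {}" by metis
    \<comment> \<open>A template solvable for a d dominating all \<open>D t\<close> is solvable for
      its own \<open>D t\<close>, contrary to the choice of D.\<close>
    obtain d where d: "continuous_pseudometric \<tau> d"
      "\<And>t u v. u \<in> X \<Longrightarrow> v \<in> X \<Longrightarrow> d u v = 0 \<Longrightarrow> D t u v = 0"
      by (rule continuous_pseudometric_countable_family[of \<tau> D, OF D(1) \<tau>(1)]) blast
    obtain t where t: "well_formed t" "solutions X f d t \<noteq> {}" using sol[OF d(1)] by blast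
    have "solutions X f d t \<subseteq> solutions X f (D t) t"
      using t(1) d(2) by (rule solutions_mono)
    then show False using t D(2) by blast
  qed
  then obtain t where t: "well_formed t"
    "\<And>d. continuous_pseudometric \<tau> d \<Longrightarrow> solutions X f d t \<noteq> {}" by blast
  let ?P = "product_topology (\<lambda>_. \<tau>) {..<fst t}"
  have "\<exists>c. \<forall>d. continuous_pseudometric \<tau> d \<longrightarrow> c \<in> solutions X f d t"
  proof (rule ccontr)
    assume no: "\<not> ?thesis"
    \<comment> \<open>These complements would cover the power. A countable subcover involves
      countably many pseudometrics, and a solution for one dominating them all lies in no member of
      it.\<close>
    define \<U> where "\<U> = {topspace ?P - solutions X f d t |d. continuous_pseudometric \<tau> d}"
    have "\<And>U. U \<in> \<U> \<Longrightarrow> openin ?P U"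
      using closedin_solutions[OF _ \<tau>(1) t(1)] unfolding \<U>_def closedin_def by blast
    moreover have "\<Union>\<U> = topspace ?P" using no unfolding \<U>_def by blast
    moreover have "Lindelof_space ?P" using \<tau>(2) by (simp add: power_Lindelof_def)
    ultimately obtain \<V> where V: "countable \<V>" "\<V> \<subseteq> \<U>" "\<Union>\<V> = topspace ?P"
      unfolding Lindelof_space_def by metis
    have sub: "solutions X f d t \<subseteq> topspace ?P" for d
      unfolding topspace_product_topology \<tau>(1) solutions_def by blast
    have "topspace ?P \<noteq> {}"
      using t(2)[OF continuous_pseudometric_zero[OF \<tau>(1)]] sub by blast
    then have ne: "\<V> \<noteq> {}" using V(3) by auto
    have "\<exists>d. continuous_pseudometric \<tau> d \<and> from_nat_into \<V> n = topspace ?P - solutions X f d t" for n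
      using from_nat_into[OF ne, of n] V(2) unfolding \<U>_def by blast
    then obtain D where D: "\<And>n. continuous_pseudometric \<tau> (D n)"
      "\<And>n. from_nat_into \<V> n = topspace ?P - solutions X f (D n) t" by metis
    obtain d where d: "continuous_pseudometric \<tau> d"
      "\<And>n u v. u \<in> X \<Longrightarrow> v \<in> X \<Longrightarrow> d u v = 0 \<Longrightarrow> D n u v = 0"
      by (rule continuous_pseudometric_countable_family[of \<tau> D, OF D(1) \<tau>(1)]) blast
    obtain c where c: "c \<in> solutions X f d t" using t(2)[OF d(1)] by blast
    then obtain V where "V \<in> \<V>" "c \<in> V" using V(3) sub by blast
    then obtain n where "c \<in> from_nat_into \<V> n" using from_nat_into_surj[OF V(1)] by metis
    have "solutions X f d t \<subseteq> solutions X f (D n) t"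
      using t(1) d(2) by (rule solutions_mono)
    then show False using D(2)[of n] c \<open>c \<in> from_nat_into \<V> n\<close> by blast
  qed
  then obtain c where c: "\<And>d. continuous_pseudometric \<tau> d \<Longrightarrow> c \<in> solutions X f d t" by blast
  have cX: "c ` {..<fst t} \<subseteq> X"
    using c[OF continuous_pseudometric_zero[OF \<tau>(1)]] by (auto simp: solutions_def)
  let ?v = "\<lambda>w x. pattern_value f (map (map_option c) w) x"
  have wf: "map (map_option c) w \<in> patterns X" "c j \<in> X" if "(w, j) \<in> set (snd t)" for w j
  proof -
    have "w \<in> patterns {..<fst t}" "j < fst t" using t(1) that by (auto simp: well_formed_def)
    then show "map (map_option c) w \<in> patterns X" "c j \<in> X" using map_option_patterns cX by auto
  qed
  have "\<exists>(w, j)\<in>set (snd t). ?v w x = c j" if x: "x \<in> X" for x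
  proof (rule ccontr)
    assume no: "\<not> ?thesis"
    \<comment> \<open>Each equation failing at x is detected by some continuous pseudometric. As c
      is a solution for a d dominating them, one of these equations holds up to d, a
      contradiction.\<close>
    have "\<exists>d. continuous_pseudometric \<tau> d \<and> ((w, j) \<in> set (snd t) \<longrightarrow> d (?v w x) (c j) > 0)" for w j
    proof (cases "(w, j) \<in> set (snd t)")
      case True
      then have "?v w x \<in> X" "c j \<in> X" "?v w x \<noteq> c j"
        using no wf pattern_value_closed x by auto
      then obtain d where "subinvariant_pseudometric X f d"
        "continuous_map (prod_topology \<tau> \<tau>) euclideanreal (\<lambda>(u, v). d u v)" "d (?v w x) (c j) > 0"
        using \<tau>(3) unfolding subinvariant_topology_def \<tau>(1) by blast
      then show ?thesis using continuous_pseudometricI \<tau>(1) by blast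
    next
      case False
      then show ?thesis using continuous_pseudometric_zero[OF \<tau>(1)] by blast
    qed
    then have "\<forall>p. \<exists>d. continuous_pseudometric \<tau> d \<and>
      (p \<in> set (snd t) \<longrightarrow> d (?v (fst p) x) (c (snd p)) > 0)" by (metis prod.collapse)
    then obtain D where D: "\<And>p. continuous_pseudometric \<tau> (D p)"
      "\<And>p. p \<in> set (snd t) \<Longrightarrow> D p (?v (fst p) x) (c (snd p)) > 0" by metis
    obtain d where d: "continuous_pseudometric \<tau> d"
      "\<And>p u v. u \<in> X \<Longrightarrow> v \<in> X \<Longrightarrow> d u v = 0 \<Longrightarrow> D p u v = 0"
      by (rule continuous_pseudometric_countable_family[of \<tau> D, OF D(1) \<tau>(1)]) blast
    obtain w j where wj: "(w, j) \<in> set (snd t)" "d (?v w x) (c j) = 0"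
      using c[OF d(1)] x unfolding solutions_def by blast
    then have "D (w, j) (?v w x) (c j) = 0"
      using d(2) pattern_value_closed[OF wf(1)[OF wj(1)] x] wf(2)[OF wj(1)] by blast
    then show False using D(2)[OF wj(1)] by simp
  qed
  moreover have "(\<lambda>(w, j). (map (map_option c) w, c j)) ` set (snd t) \<subseteq> patterns X \<times> X"
    using wf by auto
  ultimately show ?thesis
    unfolding finitely_covered_def
    by (intro exI[of _ "(\<lambda>(w, j). (map (map_option c) w, c j)) ` set (snd t)"])
      (auto simp: split_beta)
qed

end

theorem corollary3:
  fixes \<C> :: "('b topology \<times> ('b \<Rightarrow> 'b \<Rightarrow> 'b)) set"
    and X :: "'a set" and f :: "'a \<Rightarrow> 'a \<Rightarrow> 'a"
  assumes "cov_meager =o |UNIV :: real set|"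
    and "infinite (UNIV :: 'b set)" and "|X| \<le>o |UNIV :: 'b set|"
    and "\<forall>(T, g)\<in>\<C>. topological_semigroup T g"
    and "\<forall>T g. topological_semigroup T g \<and> Tychonoff_space T \<longrightarrow> (T, g) \<in> \<C>"
    and "semigroup_on X f"
    and "absolutely_closed \<C> X f"
    and "\<exists>\<tau>. topspace \<tau> = X \<and> power_Lindelof \<tau> \<and> subinvariant_topology f \<tau>"
  shows "polybounded X f"
proof -
  interpret absolutely_closed_semigroup X f \<C>
    using assms by unfold_locales auto
  have "finitely_covered X"
  proof (cases "X = {}")
    case True
    then show ?thesis unfolding finitely_covered_def by (intro exI[of _ "{}"]) auto
  next
    case False
    then show ?thesis using power_Lindelof_imp_finitely_covered[OF assms(1)] assms(8) by blast
  qed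
  then show ?thesis by (rule finitely_covered_imp_polybounded)
qed

end
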